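(* Let $n\ge 3$. Let $A\subset\mathbb{R}^{n-2}$ be any closed subset. Then there exist a linear elliptic differential operator $D$ of first order defined over $\mathbb{R}^n$ (acting between smooth sections of real vector bundles over $\mathbb{R}^n$) and a solution $\varphi$ of $D\varphi=0$ on $\mathbb{R}^n$ such that the zero set $\mathcal{N}(\varphi)=\{x\in\mathbb{R}^n\mid\varphi(x)=0\}$ satisfies $$\mathcal{N}(\varphi)=\{(0,0)\}\times A\subset\mathbb{R}^2\times\mathbb{R}^{n-2}=\mathbb{R}^n.$$ Moreover, $D$ has the strong unique continuation property.
   Context: All bundles, sections and coefficients of differential operators are $C^\infty$. A linear differential operator of first order $D:C^\infty(M,E)\to C^\infty(M,F)$ between real vector bundles over a manifold $M$ has, in local coordinates and trivializations, the form $D=\sum_{j=1}^n A_j(x)\frac{\partial}{\partial x_j}+B(x)$ with smooth matrix-valued $A_j,B$. Its principal symbol at $\xi=\sum_j\xi_j\,dx_j\in T_x^\ast M$ is $\sigma_D(\xi)=\sum_j A_j(x)\xi_j:E_x\to F_x$. $D$ is elliptic if $\sigma_D(\xi)$ is an isomorphism for all $\xi\neq0$. A section $\varphi$ vanishes at $x$ of order $k$ if, in local coordinates and a local trivialization, all partial derivatives of order $0,\dots,k-1$ of all components of $\varphi$ vanish at $x$. $\mathcal{N}_\infty(\varphi)$ is the set of points at which $\varphi$ vanishes of order $k$ for every $k$. $D$ has the strong unique continuation property if for every local solution $\varphi$ of $D\varphi=0$ (defined on a connected open subset) either $\mathcal{N}_\infty(\varphi)=\emptyset$ or $\varphi\equiv0$.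 *)

theory Defs
  imports "HOL-Analysis.Analysis" "Jordan_Normal_Form.Matrix"
begin

(* Base points and cotangent vectors live in a Euclidean space 'a (coordinates with respect to
   Basis); fibre elements and coefficient matrices are the vectors and matrices of
   Jordan_Normal_Form, whose dimensions are terms. A bundle of rank p over the Euclidean space
   is the trivial one, so that a section is a function into carrier_vec p. *)

definition partial_deriv :: "'a::euclidean_space \<Rightarrow> ('a \<Rightarrow> real) \<Rightarrow> 'a \<Rightarrow> real" where
  "partial_deriv b f x = deriv (\<lambda>t. f (x + t *\<^sub>R b)) 0"

definition iter_partial :: "'a::euclidean_space list \<Rightarrow> ('a \<Rightarrow> real) \<Rightarrow> 'a \<Rightarrow> real" where
  "iter_partial bs f = foldr partial_deriv bs f"

(* Only meant for open U; the values of f outside U are then irrelevant. *)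
definition smooth_fun_on :: "'a::euclidean_space set \<Rightarrow> ('a \<Rightarrow> real) \<Rightarrow> bool" where
  "smooth_fun_on U f \<longleftrightarrow> (\<forall>bs\<in>lists Basis. \<forall>x\<in>U. iter_partial bs f differentiable (at x))"

definition smooth_section_on ::
    "nat \<Rightarrow> 'a::euclidean_space set \<Rightarrow> ('a \<Rightarrow> real Matrix.vec) \<Rightarrow> bool" where
  "smooth_section_on p U \<phi> \<longleftrightarrow>
     (\<forall>x\<in>U. \<phi> x \<in> carrier_vec p) \<and> (\<forall>i<p. smooth_fun_on U (\<lambda>x. vec_index (\<phi> x) i))"

definition smooth_matrix :: "nat \<Rightarrow> nat \<Rightarrow> ('a::euclidean_space \<Rightarrow> real mat) \<Rightarrow> bool" where
  "smooth_matrix q p C \<longleftrightarrow>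
     (\<forall>x. C x \<in> carrier_mat q p) \<and> (\<forall>i<q. \<forall>k<p. smooth_fun_on UNIV (\<lambda>x. C x $$ (i, k)))"

(* D = sum over b in Basis of top_coeff D b x * d/dx_b, plus zero_coeff D x. *)
record 'a first_order_op =
  dom_rank :: nat
  cod_rank :: nat
  top_coeff :: "'a \<Rightarrow> 'a \<Rightarrow> real mat"
  zero_coeff :: "'a \<Rightarrow> real mat"

definition smooth_first_order_op :: "'a::euclidean_space first_order_op \<Rightarrow> bool" where
  "smooth_first_order_op D \<longleftrightarrow>
     (\<forall>b\<in>Basis. smooth_matrix (cod_rank D) (dom_rank D) (top_coeff D b)) \<and>
     smooth_matrix (cod_rank D) (dom_rank D) (zero_coeff D)"

definition apply_op ::
    "'a::euclidean_space first_order_op \<Rightarrow> ('a \<Rightarrow> real Matrix.vec) \<Rightarrow> 'a \<Rightarrow> real Matrix.vec" where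
  "apply_op D \<phi> x = Matrix.vec (cod_rank D) (\<lambda>i.
     (\<Sum>b\<in>Basis. \<Sum>k<dom_rank D.
        top_coeff D b x $$ (i, k) * partial_deriv b (\<lambda>y. vec_index (\<phi> y) k) x) +
     (\<Sum>k<dom_rank D. zero_coeff D x $$ (i, k) * vec_index (\<phi> x) k))"

definition principal_symbol :: "'a::euclidean_space first_order_op \<Rightarrow> 'a \<Rightarrow> 'a \<Rightarrow> real mat" where
  "principal_symbol D x \<xi> = Matrix.mat (cod_rank D) (dom_rank D)
     (\<lambda>(i, k). \<Sum>b\<in>Basis. top_coeff D b x $$ (i, k) * (\<xi> \<bullet> b))"

definition elliptic :: "'a::euclidean_space first_order_op \<Rightarrow> bool" where
  "elliptic D \<longleftrightarrow> (\<forall>x \<xi>. \<xi> \<noteq> 0 \<longrightarrow> invertible_mat (principal_symbol D x \<xi>))"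

definition solution_on ::
    "'a::euclidean_space first_order_op \<Rightarrow> 'a set \<Rightarrow> ('a \<Rightarrow> real Matrix.vec) \<Rightarrow> bool" where
  "solution_on D U \<phi> \<longleftrightarrow>
     smooth_section_on (dom_rank D) U \<phi> \<and> (\<forall>x\<in>U. apply_op D \<phi> x = 0\<^sub>v (cod_rank D))"

definition vanishes_of_order ::
    "nat \<Rightarrow> nat \<Rightarrow> ('a::euclidean_space \<Rightarrow> real Matrix.vec) \<Rightarrow> 'a \<Rightarrow> bool" where
  "vanishes_of_order p k \<phi> x \<longleftrightarrow>
     (\<forall>bs\<in>lists Basis. length bs < k \<longrightarrow>
        (\<forall>i<p. iter_partial bs (\<lambda>y. vec_index (\<phi> y) i) x = 0))"

definition infinite_order_zeros ::
    "nat \<Rightarrow> 'a::euclidean_space set \<Rightarrow> ('a \<Rightarrow> real Matrix.vec) \<Rightarrow> 'a set" where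
  "infinite_order_zeros p U \<phi> = {x \<in> U. \<forall>k. vanishes_of_order p k \<phi> x}"

definition zero_set ::
    "nat \<Rightarrow> 'a::euclidean_space set \<Rightarrow> ('a \<Rightarrow> real Matrix.vec) \<Rightarrow> 'a set" where
  "zero_set p U \<phi> = {x \<in> U. \<phi> x = 0\<^sub>v p}"

definition strong_unique_continuation :: "'a::euclidean_space first_order_op \<Rightarrow> bool" where
  "strong_unique_continuation D \<longleftrightarrow>
     (\<forall>U \<phi>. open U \<and> connected U \<and> solution_on D U \<phi> \<longrightarrow>
        infinite_order_zeros (dom_rank D) U \<phi> = {} \<or> (\<forall>x\<in>U. \<phi> x = 0\<^sub>v (dom_rank D)))"

end

theory Submission
  imports Defs
begin

text \<open>
  Let \<open>D\<close> be the flat Dirac operator, the sum of \<open>A b * (d / dx b)\<close> over an orthonormal basis, where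
  the \<open>A b\<close> are real symmetric anticommuting matrices with square one. Its square is the Laplacian.
  The operator of the theorem acts on pairs \<open>(u, v)\<close> by \<open>(D u, D v - Q u\<^sub>0 e\<^sub>0)\<close>, where \<open>Q\<close> is a
  smooth function, \<open>u\<^sub>0\<close> is the first component of \<open>u\<close> and \<open>e\<^sub>0\<close> is the first basis vector. It has the
  same symbol as two copies of \<open>D\<close>, so it is elliptic.

  The solution. Write \<open>(x1, x2, y)\<close> for a point, take a smooth function \<open>f\<close> of \<open>y\<close> whose zero set is
  \<open>A\<close> (\<open>closed_is_smooth_zero_set\<close>), regard it as a function \<open>F\<close> on the whole space, and let \<open>Q\<close> be
  the Laplacian of \<open>F\<close>. A solution of \<open>D w = 0\<close>, an equation with constant
  coefficients, is real analytic, so its zero set is far from arbitrary; the zeroth order term is what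
  makes room for \<open>F\<close>. With \<open>v = D (x1 F e\<^sub>0)\<close> the section \<open>D v\<close> equals \<open>x1 Q e\<^sub>0\<close>, because
  \<open>F\<close> does not depend on \<open>x1\<close>. So the equation for \<open>v\<close> holds if \<open>u\<^sub>0 = x1\<close>, and there is a solution
  \<open>u\<close> of \<open>D u = 0\<close>, linear in \<open>x1\<close> and \<open>x2\<close>, with this component that vanishes exactly where
  \<open>x1 = x2 = 0\<close>. On this subspace \<open>v\<close> is \<open>F\<close> times a nonzero constant vector, so \<open>(u, v)\<close> vanishes
  exactly on the product of the origin with \<open>A\<close> (\<open>coupled_dirac_solution\<close>).

  Strong unique continuation. The system is triangular. If \<open>(u, v)\<close> is a solution that vanishes to
  infinite order at a point, then \<open>D u = 0\<close>, hence \<open>u\<close> is harmonic and vanishes identically; now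
  \<open>D v = 0\<close>, and \<open>v\<close> vanishes for the same reason. This reduces the claim to
  \<open>harmonic_strong_unique_continuation\<close>, which holds since harmonic functions are real analytic. The
  estimate behind analyticity is \<open>harmonic_gradient_estimate\<close>, proved from the maximum principle
  without any integration; iterated on small balls, it bounds the \<open>k\<close>-th derivatives by a
  multiple of \<open>(C k / R) ^ k\<close>, so that the Taylor remainders near the point tend to zero.
\<close>

section \<open>Calculus of smooth functions\<close>

lemma partial_deriv_frechet:
  assumes "(f has_derivative f') (at x)"
  shows "partial_deriv b f x = f' b"
proof -
  have lin: "linear f'" using assms by (simp add: has_derivative_linear)
  have "((\<lambda>t. f (x + t *\<^sub>R b)) has_derivative (\<lambda>s. f' (s *\<^sub>R b))) (at 0)"
    by (rule has_derivative_compose[of "\<lambda>t. x + t *\<^sub>R b" "\<lambda>s. s *\<^sub>R b" 0 UNIV f f'])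
      (auto intro!: derivative_eq_intros simp: assms)
  moreover have "(\<lambda>s. f' (s *\<^sub>R b)) = (*) (f' b)"
    by (rule ext) (simp add: linear_cmul[OF lin])
  ultimately have "((\<lambda>t. f (x + t *\<^sub>R b)) has_real_derivative f' b) (at 0)"
    by (simp add: has_field_derivative_def)
  then show ?thesis unfolding partial_deriv_def by (rule DERIV_imp_deriv)
qed

text \<open>
  Reads the Frechet derivative off the directional derivatives, so that every rule for
  \<open>partial_deriv\<close> below reduces to the corresponding rule for \<open>has_derivative\<close>.
\<close>

lemma has_derivative_partial:
  assumes "f differentiable (at x)"
  shows "(f has_derivative (\<lambda>h. partial_deriv h f x)) (at x)"
proof -
  obtain f' where f': "(f has_derivative f') (at x)"
    using assms unfolding differentiable_def by blast
  then have "f' = (\<lambda>h. partial_deriv h f x)"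
    by (simp add: partial_deriv_frechet[OF f'])
  with f' show ?thesis by simp
qed

lemma has_real_derivative_along_line:
  assumes "f differentiable (at (x + t *\<^sub>R b))"
  shows "((\<lambda>t. f (x + t *\<^sub>R b)) has_real_derivative partial_deriv b f (x + t *\<^sub>R b)) (at t)"
proof -
  let ?y = "x + t *\<^sub>R b"
  have f': "(f has_derivative (\<lambda>h. partial_deriv h f ?y)) (at ?y)"
    by (rule has_derivative_partial[OF assms])
  then have lin: "linear (\<lambda>h. partial_deriv h f ?y)" by (simp add: has_derivative_linear)
  have "((\<lambda>t. f (x + t *\<^sub>R b)) has_derivative (\<lambda>s. partial_deriv (s *\<^sub>R b) f ?y)) (at t)"
    by (rule has_derivative_compose[of "\<lambda>t. x + t *\<^sub>R b" "\<lambda>s. s *\<^sub>R b" t UNIV f])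
      (auto intro!: derivative_eq_intros simp: f')
  moreover have "(\<lambda>s. partial_deriv (s *\<^sub>R b) f ?y) = (*) (partial_deriv b f ?y)"
    by (rule ext) (simp add: linear_cmul[OF lin])
  ultimately show ?thesis
    by (simp add: has_field_derivative_def)
qed

lemma partial_deriv_const [simp]: "partial_deriv b (\<lambda>_. c) x = 0"
  by (rule partial_deriv_frechet[where f'="\<lambda>_. 0"]) simp

lemma partial_deriv_linear: "bounded_linear f \<Longrightarrow> partial_deriv b f x = f b"
  by (rule partial_deriv_frechet) (rule bounded_linear_imp_has_derivative)

lemma partial_deriv_inner [simp]: "partial_deriv b (\<lambda>y. inner y a) x = inner b a"
  by (rule partial_deriv_linear) (rule bounded_linear_inner_left)

lemma partial_deriv_add:
  assumes "f differentiable (at x)" "g differentiable (at x)"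
  shows "partial_deriv b (\<lambda>y. f y + g y) x = partial_deriv b f x + partial_deriv b g x"
  by (rule partial_deriv_frechet)
    (intro has_derivative_add has_derivative_partial assms)

lemma partial_deriv_diff:
  assumes "f differentiable (at x)" "g differentiable (at x)"
  shows "partial_deriv b (\<lambda>y. f y - g y) x = partial_deriv b f x - partial_deriv b g x"
  by (rule partial_deriv_frechet)
    (intro has_derivative_diff has_derivative_partial assms)

lemma partial_deriv_sum:
  assumes "\<And>i. i \<in> I \<Longrightarrow> f i differentiable (at x)"
  shows "partial_deriv b (\<lambda>y. \<Sum>i\<in>I. f i y) x = (\<Sum>i\<in>I. partial_deriv b (f i) x)"
  by (rule partial_deriv_frechet)
    (intro has_derivative_sum has_derivative_partial assms)

lemma partial_deriv_mult:
  fixes f g :: "'a::euclidean_space \<Rightarrow> real"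
  assumes "f differentiable (at x)" "g differentiable (at x)"
  shows "partial_deriv b (\<lambda>y. f y * g y) x = f x * partial_deriv b g x + partial_deriv b f x * g x"
  by (rule partial_deriv_frechet)
    (intro has_derivative_mult has_derivative_partial assms)

lemma partial_deriv_cmult:
  fixes f :: "'a::euclidean_space \<Rightarrow> real"
  assumes "f differentiable (at x)"
  shows "partial_deriv b (\<lambda>y. c * f y) x = c * partial_deriv b f x"
  by (rule partial_deriv_frechet)
    (intro has_derivative_mult_right has_derivative_partial assms)

lemma partial_deriv_chain:
  fixes q :: "'a::euclidean_space \<Rightarrow> real"
  assumes "q differentiable (at x)" and "(h has_real_derivative h') (at (q x))"
  shows "partial_deriv b (\<lambda>y. h (q y)) x = h' * partial_deriv b q x"
  by (rule partial_deriv_frechet)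
    (rule has_derivative_compose[OF has_derivative_partial[OF assms(1)]
       has_field_derivative_imp_has_derivative[OF assms(2)]])

lemma partial_deriv_basis_expansion:
  fixes f :: "'a::euclidean_space \<Rightarrow> real"
  assumes "f differentiable (at x)"
  shows "partial_deriv h f x = (\<Sum>b\<in>Basis. inner h b * partial_deriv b f x)"
proof -
  have lin: "linear (\<lambda>h. partial_deriv h f x)"
    using has_derivative_partial[OF assms] by (simp add: has_derivative_linear)
  have "partial_deriv h f x = partial_deriv (\<Sum>b\<in>Basis. inner h b *\<^sub>R b) f x"
    by (simp add: euclidean_representation)
  also have "\<dots> = (\<Sum>b\<in>Basis. inner h b * partial_deriv b f x)"
    using linear_sum[OF lin, of "\<lambda>b. inner h b *\<^sub>R b" Basis] by (simp add: linear_cmul[OF lin])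
  finally show ?thesis .
qed

lemma partial_deriv_cong:
  assumes "open U" "x \<in> U" "\<And>y. y \<in> U \<Longrightarrow> f y = g y"
  shows "partial_deriv b f x = partial_deriv b g x"
  unfolding partial_deriv_def
proof (rule deriv_cong_ev)
  have "continuous (at 0) (\<lambda>t. x + t *\<^sub>R b)" by (intro continuous_intros)
  then have "((\<lambda>t. x + t *\<^sub>R b) \<longlongrightarrow> x) (nhds 0)"
    by (simp add: continuous_at tendsto_nhds_iff)
  then have "eventually (\<lambda>t. x + t *\<^sub>R b \<in> U) (nhds 0)"
    using assms(1,2) by (rule topological_tendstoD)
  then show "\<forall>\<^sub>F t in nhds 0. f (x + t *\<^sub>R b) = g (x + t *\<^sub>R b)"
    by eventually_elim (use assms(3) in auto)
qed simp

lemma differentiable_cong_open: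
  assumes "open U" "x \<in> U" "\<And>y. y \<in> U \<Longrightarrow> f y = g y" "f differentiable (at x)"
  shows "g differentiable (at x)"
  using assms has_derivative_transform_within_open[of f _ x UNIV U g]
  unfolding differentiable_def by metis

lemma iter_partial_Nil [simp]: "iter_partial [] f = f"
  and iter_partial_Cons [simp]: "iter_partial (b # bs) f = partial_deriv b (iter_partial bs f)"
  and iter_partial_snoc: "iter_partial (bs @ [b]) f = iter_partial bs (partial_deriv b f)"
  by (simp_all add: iter_partial_def)

lemma iter_partial_append: "iter_partial (bs @ cs) f = iter_partial bs (iter_partial cs f)"
  by (simp add: iter_partial_def)

lemma iter_partial_cong:
  assumes "open U" "\<And>y. y \<in> U \<Longrightarrow> f y = g y" "x \<in> U"
  shows "iter_partial bs f x = iter_partial bs g x"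
  using assms(3)
proof (induction bs arbitrary: x)
  case Nil then show ?case using assms by simp
next
  case (Cons b bs)
  show ?case by (simp, rule partial_deriv_cong[OF assms(1) Cons.prems Cons.IH])
qed

lemma smooth_fun_on_differentiable:
  "smooth_fun_on U f \<Longrightarrow> x \<in> U \<Longrightarrow> f differentiable (at x)"
  unfolding smooth_fun_on_def by (metis iter_partial_Nil lists.Nil)

lemma smooth_fun_on_iter_partial:
  fixes f :: "'a::euclidean_space \<Rightarrow> real"
  assumes "smooth_fun_on U f" "bs \<in> lists Basis"
  shows "smooth_fun_on U (iter_partial bs f)"
  unfolding smooth_fun_on_def
proof (intro ballI)
  fix cs :: "'a list" and x assume "cs \<in> lists Basis" "x \<in> U"
  then have "cs @ bs \<in> lists Basis" using assms by simp
  then show "iter_partial cs (iter_partial bs f) differentiable at x"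
    using assms(1) \<open>x \<in> U\<close> unfolding smooth_fun_on_def by (metis iter_partial_append)
qed

lemma smooth_fun_on_partial:
  "smooth_fun_on U f \<Longrightarrow> b \<in> Basis \<Longrightarrow> smooth_fun_on U (partial_deriv b f)"
  using smooth_fun_on_iter_partial[of U f "[b]"] by simp

lemma smooth_fun_on_cong:
  assumes "open U" "\<And>y. y \<in> U \<Longrightarrow> f y = g y" "smooth_fun_on U f"
  shows "smooth_fun_on U g"
  unfolding smooth_fun_on_def
proof (intro ballI)
  fix bs :: "'a list" and x assume bs: "bs \<in> lists Basis" and x: "x \<in> U"
  show "iter_partial bs g differentiable (at x)"
    by (rule differentiable_cong_open[OF assms(1) x iter_partial_cong[OF assms(1,2)]])
      (use assms(3) bs x in \<open>auto simp: smooth_fun_on_def\<close>)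
qed

text \<open>
  Smoothness is the greatest class of differentiable functions that is closed under partial
  derivatives. To show that a function is smooth it therefore suffices to exhibit one such class
  containing it, which avoids any formula for iterated derivatives of products, compositions or
  series. The derivatives need to lie in the class only up to equality on \<open>U\<close>, because the operators
  \<open>partial_deriv\<close> are local on open sets.
\<close>

lemma smooth_fun_on_coinduct:
  assumes "open U" "f \<in> F"
    and diff: "\<And>g x. g \<in> F \<Longrightarrow> x \<in> U \<Longrightarrow> g differentiable (at x)"
    and step: "\<And>g b. g \<in> F \<Longrightarrow> b \<in> Basis \<Longrightarrow> \<exists>h\<in>F. \<forall>x\<in>U. partial_deriv b g x = h x"
  shows "smooth_fun_on U f"
proof -
  have *: "\<exists>h\<in>F. \<forall>x\<in>U. iter_partial bs f x = h x" if "bs \<in> lists Basis" for bs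
    using that
  proof (induction bs)
    case Nil then show ?case using assms(2) by auto
  next
    case (Cons b bs)
    then obtain h where h: "h \<in> F" "\<forall>x\<in>U. iter_partial bs f x = h x" by auto
    obtain k where k: "k \<in> F" "\<forall>x\<in>U. partial_deriv b h x = k x"
      using step[OF h(1)] Cons.hyps by blast
    have "partial_deriv b (iter_partial bs f) x = k x" if "x \<in> U" for x
      using partial_deriv_cong[OF assms(1) that, of "iter_partial bs f" h b] h k that by auto
    then show ?case using k by auto
  qed
  show ?thesis
    unfolding smooth_fun_on_def
  proof (intro ballI)
    fix bs :: "'a list" and x assume bs: "bs \<in> lists Basis" and x: "x \<in> U"
    obtain h where h: "h \<in> F" "\<forall>x\<in>U. iter_partial bs f x = h x" using *[OF bs] by auto
    show "iter_partial bs f differentiable (at x)"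
      by (rule differentiable_cong_open[OF assms(1) x _ diff[OF h(1) x]]) (use h in auto)
  qed
qed

lemma smooth_fun_on_const: "open U \<Longrightarrow> smooth_fun_on U (\<lambda>_. c)"
  by (rule smooth_fun_on_coinduct[where F = "range (\<lambda>c _. c)"])
    (auto intro!: exI[of _ 0])

lemma smooth_fun_on_linear:
  assumes "open U" "bounded_linear f"
  shows "smooth_fun_on U f"
proof (rule smooth_fun_on_coinduct[where F = "insert f (range (\<lambda>c _. c))"])
  show "g differentiable (at x)" if "g \<in> insert f (range (\<lambda>c _. c))" for g x
    using that bounded_linear_imp_differentiable[OF assms(2)] by auto
  show "\<exists>h\<in>insert f (range (\<lambda>c _. c)). \<forall>x\<in>U. partial_deriv b g x = h x"
    if "g \<in> insert f (range (\<lambda>c _. c))" for g b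
    using that partial_deriv_linear[OF assms(2)] by auto
qed (use assms in auto)

text \<open>
  The extra factor \<open>t ^ j\<close> in the denominator makes the family closed under differentiation, up to
  linear combinations (\<open>DERIV_flat_exp\<close>); \<open>j = 0\<close> is the classical smooth function that vanishes
  exactly on the nonpositive half line.
\<close>

definition flat_exp :: "nat \<Rightarrow> real \<Rightarrow> real" where
  "flat_exp j t = (if t > 0 then exp (- 1 / t) / t ^ j else 0)"

lemma flat_exp_tendsto_0: "flat_exp j \<midarrow>0\<rightarrow> 0"
proof -
  have "((\<lambda>t::real. inverse t ^ j / exp (inverse t)) \<longlongrightarrow> 0) (at_right 0)"
    by (rule filterlim_compose[OF tendsto_power_div_exp_0 filterlim_inverse_at_top_right])
  moreover have "\<forall>\<^sub>F t in at_right 0. inverse t ^ j / exp (inverse t) = flat_exp j t"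
    unfolding eventually_at_right_field
    by (intro exI[of _ 1]) (auto simp: flat_exp_def exp_minus field_simps)
  ultimately have r: "(flat_exp j \<longlongrightarrow> 0) (at_right 0)" by (rule Lim_transform_eventually)
  have "\<forall>\<^sub>F t in at_left (0::real). 0 = flat_exp j t"
    unfolding eventually_at_left_field by (intro exI[of _ "-1"]) (auto simp: flat_exp_def)
  with tendsto_const have l: "(flat_exp j \<longlongrightarrow> 0) (at_left 0)" by (rule Lim_transform_eventually)
  show ?thesis using l r by (simp add: filterlim_at_split)
qed

lemma DERIV_flat_exp:
  "(flat_exp j has_real_derivative (flat_exp (j + 2) t - real j * flat_exp (j + 1) t)) (at t)"
proof (cases t "0::real" rule: linorder_cases)
  case less
  have "((\<lambda>_. 0) has_real_derivative 0) (at t)" by simp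
  then have "(flat_exp j has_real_derivative 0) (at t)"
    by (rule has_field_derivative_transform_within_open[where S = "{..<0}"])
      (use less in \<open>auto simp: flat_exp_def\<close>)
  then show ?thesis using less by (simp add: flat_exp_def)
next
  case greater
  have "((\<lambda>t. exp (- 1 / t) / t ^ j) has_real_derivative
      (flat_exp (j + 2) t - real j * flat_exp (j + 1) t)) (at t)"
  proof (cases j)
    case 0
    then show ?thesis using greater
      by (auto intro!: derivative_eq_intros simp: flat_exp_def field_simps power2_eq_square)
  next
    case (Suc i)
    then show ?thesis using greater
      by (auto intro!: derivative_eq_intros simp: flat_exp_def field_simps power2_eq_square)
        (metis One_nat_def power_eq_if)
  qed
  then show ?thesis
    by (rule has_field_derivative_transform_within_open[where S = "{0<..}"])
      (use greater in \<open>auto simp: flat_exp_def\<close>)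
next
  case equal
  have "\<forall>\<^sub>F s in at 0. flat_exp (Suc j) s = (flat_exp j (0 + s) - flat_exp j 0) / s"
    by (simp add: eventually_at_filter flat_exp_def)
  with flat_exp_tendsto_0 have "(\<lambda>s. (flat_exp j (0 + s) - flat_exp j 0) / s) \<midarrow>0\<rightarrow> 0"
    by (rule Lim_transform_eventually)
  then have "(flat_exp j has_real_derivative 0) (at 0)" by (simp add: DERIV_def)
  then show ?thesis using equal by (simp add: flat_exp_def)
qed

text \<open>
  A class to which \<open>smooth_fun_on_coinduct\<close> applies: by the Leibniz rule, the chain rule and
  \<open>DERIV_flat_exp\<close>, it is closed under partial derivatives. Its closure properties then pass to
  smooth functions.
\<close>

inductive smooth_alg :: "'a::euclidean_space set \<Rightarrow> ('a \<Rightarrow> real) \<Rightarrow> bool" for U where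
  base: "smooth_fun_on U f \<Longrightarrow> smooth_alg U f"
| comp: "smooth_fun_on U q \<Longrightarrow> smooth_alg U (\<lambda>x. flat_exp j (q x))"
| add: "smooth_alg U f \<Longrightarrow> smooth_alg U g \<Longrightarrow> smooth_alg U (\<lambda>x. f x + g x)"
| mult: "smooth_alg U f \<Longrightarrow> smooth_alg U g \<Longrightarrow> smooth_alg U (\<lambda>x. f x * g x)"

lemma flat_exp_comp_differentiable:
  fixes q :: "'a::euclidean_space \<Rightarrow> real"
  shows "q differentiable (at x) \<Longrightarrow> (\<lambda>x. flat_exp j (q x)) differentiable (at x)"
  unfolding differentiable_def
  by (blast intro: has_derivative_compose has_field_derivative_imp_has_derivative[OF DERIV_flat_exp])

lemma smooth_alg_differentiable:
  "smooth_alg U f \<Longrightarrow> x \<in> U \<Longrightarrow> f differentiable (at x)"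
  by (induction rule: smooth_alg.induct)
    (auto intro: smooth_fun_on_differentiable flat_exp_comp_differentiable)

lemma smooth_alg_smooth:
  assumes "open U" "smooth_alg U f"
  shows "smooth_fun_on U f"
proof (rule smooth_fun_on_coinduct[where F = "Collect (smooth_alg U)"])
  fix g and b :: 'a assume "g \<in> Collect (smooth_alg U)" and b: "b \<in> Basis"
  then have "smooth_alg U g" by simp
  then show "\<exists>h\<in>Collect (smooth_alg U). \<forall>x\<in>U. partial_deriv b g x = h x"
  proof induction
    case (base f)
    then show ?case using smooth_fun_on_partial[OF _ b] by (auto intro: smooth_alg.base)
  next
    case (comp q j)
    let ?h = "\<lambda>x. (flat_exp (j + 2) (q x) + (- real j) * flat_exp (j + 1) (q x)) * partial_deriv b q x"
    have "smooth_alg U ?h"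
      by (intro smooth_alg.mult smooth_alg.add smooth_alg.comp[OF comp]
          smooth_alg.base[OF smooth_fun_on_const[OF assms(1)]]
          smooth_alg.base[OF smooth_fun_on_partial[OF comp b]])
    moreover have "partial_deriv b (\<lambda>x. flat_exp j (q x)) x = ?h x" if "x \<in> U" for x
      using partial_deriv_chain[OF smooth_fun_on_differentiable[OF comp that] DERIV_flat_exp] by simp
    ultimately show ?case by auto
  next
    case (add f g)
    then obtain f' g' where "smooth_alg U f'" "smooth_alg U g'"
      "\<forall>x\<in>U. partial_deriv b f x = f' x" "\<forall>x\<in>U. partial_deriv b g x = g' x" by auto
    then show ?case
      using add by (intro bexI[of _ "\<lambda>x. f' x + g' x"])
        (auto intro: smooth_alg.add simp: partial_deriv_add smooth_alg_differentiable)
  next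
    case (mult f g)
    then obtain f' g' where "smooth_alg U f'" "smooth_alg U g'"
      "\<forall>x\<in>U. partial_deriv b f x = f' x" "\<forall>x\<in>U. partial_deriv b g x = g' x" by auto
    then show ?case
      using mult by (intro bexI[of _ "\<lambda>x. f x * g' x + f' x * g x"])
        (auto intro!: smooth_alg.add smooth_alg.mult simp: partial_deriv_mult smooth_alg_differentiable)
  qed
qed (use assms in \<open>auto intro: smooth_alg_differentiable\<close>)

lemma smooth_fun_on_add:
  "open U \<Longrightarrow> smooth_fun_on U f \<Longrightarrow> smooth_fun_on U g \<Longrightarrow> smooth_fun_on U (\<lambda>x. f x + g x)"
  by (blast intro: smooth_alg_smooth smooth_alg.intros)

lemma smooth_fun_on_mult:
  "open U \<Longrightarrow> smooth_fun_on U f \<Longrightarrow> smooth_fun_on U g \<Longrightarrow> smooth_fun_on U (\<lambda>x. f x * g x)"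
  by (blast intro: smooth_alg_smooth smooth_alg.intros)

lemma smooth_fun_on_flat_exp:
  "open U \<Longrightarrow> smooth_fun_on U q \<Longrightarrow> smooth_fun_on U (\<lambda>x. flat_exp j (q x))"
  by (blast intro: smooth_alg_smooth smooth_alg.intros)

lemma smooth_fun_on_cmult:
  "open U \<Longrightarrow> smooth_fun_on U f \<Longrightarrow> smooth_fun_on U (\<lambda>x. c * f x)"
  by (intro smooth_fun_on_mult smooth_fun_on_const)

lemma smooth_fun_on_diff:
  "open U \<Longrightarrow> smooth_fun_on U f \<Longrightarrow> smooth_fun_on U g \<Longrightarrow> smooth_fun_on U (\<lambda>x. f x - g x)"
  using smooth_fun_on_add[of U f "\<lambda>x. (-1) * g x"] smooth_fun_on_cmult[of U g "-1"] by simp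

lemma smooth_fun_on_sum:
  assumes "open U" "\<And>i. i \<in> I \<Longrightarrow> smooth_fun_on U (f i)"
  shows "smooth_fun_on U (\<lambda>x. \<Sum>i\<in>I. f i x)"
  using assms(2)
  by (induction I rule: infinite_finite_induct)
    (auto intro!: smooth_fun_on_const smooth_fun_on_add assms(1))

lemma smooth_fun_on_inner: "open U \<Longrightarrow> smooth_fun_on U (\<lambda>x. inner x a)"
  by (intro smooth_fun_on_linear bounded_linear_inner_left)

lemma smooth_fun_on_directional:
  assumes "open U" "smooth_fun_on U f"
  shows "smooth_fun_on U (partial_deriv h f)"
proof (rule smooth_fun_on_cong[OF assms(1)])
  show "smooth_fun_on U (\<lambda>x. \<Sum>b\<in>Basis. inner h b * partial_deriv b f x)"
    using assms by (intro smooth_fun_on_sum smooth_fun_on_cmult smooth_fun_on_partial)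
qed (use partial_deriv_basis_expansion[OF smooth_fun_on_differentiable[OF assms(2)]] in simp)

lemma smooth_fun_on_continuous_on:
  "smooth_fun_on U f \<Longrightarrow> continuous_on U f"
  by (intro continuous_at_imp_continuous_on ballI differentiable_imp_continuous_within
      smooth_fun_on_differentiable)

text \<open>
  Two applications of the mean value theorem, first along \<open>h\<close> and then along \<open>k\<close>. The second
  difference on the left is symmetric in \<open>h\<close> and \<open>k\<close>, which is what makes the mixed derivatives agree
  in the next lemma.
\<close>

lemma second_difference_mean_value:
  assumes U: "open U" "ball x e \<subseteq> U" "smooth_fun_on U f"
    and t: "0 < t" "t * (norm h + norm k) < e"
  shows "\<exists>y\<in>ball x e. f (x + t *\<^sub>R h + t *\<^sub>R k) - f (x + t *\<^sub>R h) - (f (x + t *\<^sub>R k) - f x)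
    = t\<^sup>2 * partial_deriv k (partial_deriv h f) y"
proof -
  have inb: "x + s *\<^sub>R h + r *\<^sub>R k \<in> ball x e" if "0 \<le> s" "s \<le> t" "0 \<le> r" "r \<le> t" for s r
  proof -
    have "norm (s *\<^sub>R h + r *\<^sub>R k) \<le> s * norm h + r * norm k"
      using norm_triangle_ineq[of "s *\<^sub>R h" "r *\<^sub>R k"] that by simp
    also have "\<dots> \<le> t * norm h + t * norm k"
      using that by (intro add_mono mult_right_mono) auto
    also have "\<dots> < e" using t by (simp add: algebra_simps)
    finally show ?thesis
      by (simp add: mem_ball dist_commute[of x]) (simp add: dist_norm add.assoc)
  qed
  have d: "f differentiable (at y)" "partial_deriv h f differentiable (at y)" if "y \<in> ball x e" for y
    using that U(2) smooth_fun_on_differentiable[OF U(3)]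
      smooth_fun_on_differentiable[OF smooth_fun_on_directional[OF U(1,3)]] by blast+
  let ?\<phi> = "\<lambda>s. f ((x + t *\<^sub>R k) + s *\<^sub>R h) - f (x + s *\<^sub>R h)"
  have "\<exists>z. 0 < z \<and> z < t \<and> ?\<phi> t - ?\<phi> 0 = (t - 0) *
     (partial_deriv h f ((x + t *\<^sub>R k) + z *\<^sub>R h) - partial_deriv h f (x + z *\<^sub>R h))"
  proof (rule MVT2[OF t(1)])
    fix s assume s: "0 \<le> s" "s \<le> t"
    show "(?\<phi> has_real_derivative
      (partial_deriv h f ((x + t *\<^sub>R k) + s *\<^sub>R h) - partial_deriv h f (x + s *\<^sub>R h))) (at s)"
      using inb[OF s, of t] inb[OF s, of 0] t
      by (intro DERIV_diff has_real_derivative_along_line d) (auto simp: algebra_simps)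
  qed
  then obtain z where z: "0 < z" "z < t" "?\<phi> t - ?\<phi> 0 = t *
     (partial_deriv h f ((x + t *\<^sub>R k) + z *\<^sub>R h) - partial_deriv h f (x + z *\<^sub>R h))" by auto
  have "\<exists>w. 0 < w \<and> w < t \<and> partial_deriv h f ((x + z *\<^sub>R h) + t *\<^sub>R k) - partial_deriv h f ((x + z *\<^sub>R h) + 0 *\<^sub>R k)
     = (t - 0) * partial_deriv k (partial_deriv h f) ((x + z *\<^sub>R h) + w *\<^sub>R k)"
  proof (rule MVT2[OF t(1)])
    fix s assume s: "0 \<le> s" "s \<le> t"
    show "((\<lambda>s. partial_deriv h f ((x + z *\<^sub>R h) + s *\<^sub>R k)) has_real_derivative
      partial_deriv k (partial_deriv h f) ((x + z *\<^sub>R h) + s *\<^sub>R k)) (at s)"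
      using inb[of z s] z s by (intro has_real_derivative_along_line d) auto
  qed
  then obtain w where w: "0 < w" "w < t"
    "partial_deriv h f (x + z *\<^sub>R h + t *\<^sub>R k) - partial_deriv h f (x + z *\<^sub>R h)
     = t * partial_deriv k (partial_deriv h f) (x + z *\<^sub>R h + w *\<^sub>R k)" by auto
  show ?thesis
  proof (rule bexI[of _ "x + z *\<^sub>R h + w *\<^sub>R k"])
    show "x + z *\<^sub>R h + w *\<^sub>R k \<in> ball x e" using inb[of z w] z w by auto
    have "f (x + t *\<^sub>R h + t *\<^sub>R k) - f (x + t *\<^sub>R h) - (f (x + t *\<^sub>R k) - f x) = ?\<phi> t - ?\<phi> 0"
      by (simp add: algebra_simps)
    also have "\<dots> = t * (t * partial_deriv k (partial_deriv h f) (x + z *\<^sub>R h + w *\<^sub>R k))"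
      unfolding z(3) w(3)[symmetric] by (simp add: algebra_simps)
    finally show "f (x + t *\<^sub>R h + t *\<^sub>R k) - f (x + t *\<^sub>R h) - (f (x + t *\<^sub>R k) - f x)
      = t\<^sup>2 * partial_deriv k (partial_deriv h f) (x + z *\<^sub>R h + w *\<^sub>R k)"
      by (simp add: power2_eq_square)
  qed
qed

lemma partial_deriv_commute:
  assumes U: "open U" "smooth_fun_on U f" "x \<in> U"
  shows "partial_deriv h (partial_deriv k f) x = partial_deriv k (partial_deriv h f) x"
proof (rule ccontr)
  let ?p = "partial_deriv h (partial_deriv k f)" and ?q = "partial_deriv k (partial_deriv h f)"
  assume ne: "?p x \<noteq> ?q x"
  define d where "d = dist (?p x) (?q x) / 2"
  have d: "d > 0" using ne by (simp add: d_def)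
  have sm: "smooth_fun_on U ?p" "smooth_fun_on U ?q"
    using U by (auto intro: smooth_fun_on_directional)
  then have "continuous (at x) ?p" "continuous (at x) ?q"
    using U(3) by (auto intro: differentiable_imp_continuous_within smooth_fun_on_differentiable)
  then obtain e1 e2 where e12: "e1 > 0" "\<And>y. dist y x < e1 \<Longrightarrow> dist (?p y) (?p x) < d"
    "e2 > 0" "\<And>y. dist y x < e2 \<Longrightarrow> dist (?q y) (?q x) < d"
    using d unfolding continuous_at_eps_delta by (metis dist_norm dist_commute)
  obtain e3 where e3: "e3 > 0" "ball x e3 \<subseteq> U" using U by (meson openE)
  define e where "e = min e3 (min e1 e2)"
  have e: "e > 0" "ball x e \<subseteq> U" using e3 e12 by (auto simp: e_def)
  define t where "t = e / (norm h + norm k + 1)"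
  have np: "norm h + norm k + 1 > 0" by (smt (verit) norm_ge_zero)
  have t: "t > 0" using e np by (simp add: t_def)
  have "t * (norm h + norm k) < t * (norm h + norm k + 1)" using t by simp
  also have "\<dots> = e" using np by (simp add: t_def)
  finally have te: "t * (norm h + norm k) < e" .
  obtain y where y: "y \<in> ball x e"
    "f (x + t *\<^sub>R h + t *\<^sub>R k) - f (x + t *\<^sub>R h) - (f (x + t *\<^sub>R k) - f x) = t\<^sup>2 * ?q y"
    using second_difference_mean_value[OF U(1) e(2) U(2) t te] by auto
  obtain z where z: "z \<in> ball x e"
    "f (x + t *\<^sub>R k + t *\<^sub>R h) - f (x + t *\<^sub>R k) - (f (x + t *\<^sub>R h) - f x) = t\<^sup>2 * ?p z"
    using second_difference_mean_value[OF U(1) e(2) U(2) t, of k h] te by (auto simp: add.commute)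
  have "t\<^sup>2 * ?q y = t\<^sup>2 * ?p z" using y(2) z(2) by (simp add: algebra_simps)
  then have "?q y = ?p z" using t by simp
  moreover have "dist y x < e2" "dist z x < e1"
    using y(1) z(1) by (auto simp: e_def dist_commute)
  then have "dist (?q y) (?q x) < d" "dist (?p z) (?p x) < d"
    using e12 by blast+
  ultimately show False
    using dist_triangle2[of "?p x" "?q x" "?p z"] by (simp add: d_def dist_commute)
qed

section \<open>Harmonic functions\<close>

definition laplacian :: "('a::euclidean_space \<Rightarrow> real) \<Rightarrow> 'a \<Rightarrow> real" where
  "laplacian f x = (\<Sum>b\<in>Basis. partial_deriv b (partial_deriv b f) x)"

definition harmonic_on :: "'a::euclidean_space set \<Rightarrow> ('a \<Rightarrow> real) \<Rightarrow> bool" where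
  "harmonic_on U f \<longleftrightarrow> smooth_fun_on U f \<and> (\<forall>x\<in>U. laplacian f x = 0)"

lemma smooth_fun_on_laplacian:
  "open U \<Longrightarrow> smooth_fun_on U f \<Longrightarrow> smooth_fun_on U (laplacian f)"
  unfolding laplacian_def by (intro smooth_fun_on_sum smooth_fun_on_partial)

lemma partial_deriv_add_smooth:
  "smooth_fun_on U f \<Longrightarrow> smooth_fun_on U g \<Longrightarrow> x \<in> U \<Longrightarrow>
   partial_deriv b (\<lambda>y. f y + g y) x = partial_deriv b f x + partial_deriv b g x"
  by (intro partial_deriv_add smooth_fun_on_differentiable)

lemma partial_deriv_mult_smooth:
  "smooth_fun_on U f \<Longrightarrow> smooth_fun_on U g \<Longrightarrow> x \<in> U \<Longrightarrow>
   partial_deriv b (\<lambda>y. f y * g y) x = f x * partial_deriv b g x + partial_deriv b f x * g x"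
  by (intro partial_deriv_mult smooth_fun_on_differentiable)

lemma second_partial_add:
  assumes U: "open U" "smooth_fun_on U f" "smooth_fun_on U g" "x \<in> U" and b: "b \<in> Basis"
  shows "partial_deriv b (partial_deriv b (\<lambda>y. f y + g y)) x
    = partial_deriv b (partial_deriv b f) x + partial_deriv b (partial_deriv b g) x"
proof -
  have "partial_deriv b (partial_deriv b (\<lambda>y. f y + g y)) x
     = partial_deriv b (\<lambda>y. partial_deriv b f y + partial_deriv b g y) x"
    by (rule partial_deriv_cong[OF U(1,4)]) (rule partial_deriv_add_smooth[OF U(2,3)])
  also have "\<dots> = partial_deriv b (partial_deriv b f) x + partial_deriv b (partial_deriv b g) x"
    by (rule partial_deriv_add_smooth[OF _ _ U(4)]) (intro smooth_fun_on_partial U b)+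
  finally show ?thesis .
qed

lemma second_partial_mult:
  assumes U: "open U" "smooth_fun_on U f" "smooth_fun_on U g" "x \<in> U" and b: "b \<in> Basis"
  shows "partial_deriv b (partial_deriv b (\<lambda>y. f y * g y)) x
    = f x * partial_deriv b (partial_deriv b g) x + 2 * (partial_deriv b f x * partial_deriv b g x)
      + partial_deriv b (partial_deriv b f) x * g x"
proof -
  note s = smooth_fun_on_partial[OF U(2) b] smooth_fun_on_partial[OF U(3) b]
  have "partial_deriv b (partial_deriv b (\<lambda>y. f y * g y)) x
     = partial_deriv b (\<lambda>y. f y * partial_deriv b g y + partial_deriv b f y * g y) x"
    by (rule partial_deriv_cong[OF U(1,4)]) (rule partial_deriv_mult_smooth[OF U(2,3)])
  also have "\<dots> = partial_deriv b (\<lambda>y. f y * partial_deriv b g y) x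
      + partial_deriv b (\<lambda>y. partial_deriv b f y * g y) x"
    by (rule partial_deriv_add_smooth[OF _ _ U(4)]) (intro smooth_fun_on_mult U s)+
  also have "\<dots> = (f x * partial_deriv b (partial_deriv b g) x + partial_deriv b f x * partial_deriv b g x)
     + (partial_deriv b f x * partial_deriv b g x + partial_deriv b (partial_deriv b f) x * g x)"
    using partial_deriv_mult_smooth[OF U(2) s(2) U(4)] partial_deriv_mult_smooth[OF s(1) U(3) U(4)]
    by simp
  finally show ?thesis by simp
qed

lemma laplacian_add:
  assumes "open U" "smooth_fun_on U f" "smooth_fun_on U g" "x \<in> U"
  shows "laplacian (\<lambda>y. f y + g y) x = laplacian f x + laplacian g x"
  unfolding laplacian_def by (simp add: second_partial_add[OF assms] sum.distrib)

lemma laplacian_mult: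
  assumes "open U" "smooth_fun_on U f" "smooth_fun_on U g" "x \<in> U"
  shows "laplacian (\<lambda>y. f y * g y) x = f x * laplacian g x
    + 2 * (\<Sum>b\<in>Basis. partial_deriv b f x * partial_deriv b g x) + laplacian f x * g x"
  unfolding laplacian_def
  by (simp add: second_partial_mult[OF assms] sum.distrib sum_distrib_left sum_distrib_right)

lemma second_partial_const: "partial_deriv b (partial_deriv b (\<lambda>_. c)) x = 0"
proof -
  have "partial_deriv b (\<lambda>_::'a. c) = (\<lambda>_. 0)" by (rule ext) simp
  then show ?thesis by simp
qed

lemma laplacian_const: "laplacian (\<lambda>_. c) x = 0"
  by (simp add: laplacian_def second_partial_const)

lemma laplacian_cmult:
  assumes "open U" "smooth_fun_on U f" "x \<in> U"
  shows "laplacian (\<lambda>y. c * f y) x = c * laplacian f x"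
  using laplacian_mult[OF assms(1) smooth_fun_on_const[OF assms(1)] assms(2,3), of c]
  by (simp add: laplacian_const)

text \<open>
  The Laplacian has constant coefficients, hence commutes with every directional derivative.
\<close>

lemma harmonic_on_directional:
  assumes U: "open U" and f: "harmonic_on U f"
  shows "harmonic_on U (partial_deriv h f)"
  unfolding harmonic_on_def
proof (intro conjI ballI)
  have s: "smooth_fun_on U f" using f by (simp add: harmonic_on_def)
  show "smooth_fun_on U (partial_deriv h f)" by (rule smooth_fun_on_directional[OF U s])
  fix x assume x: "x \<in> U"
  have "laplacian (partial_deriv h f) x = (\<Sum>b\<in>Basis. partial_deriv h (partial_deriv b (partial_deriv b f)) x)"
    unfolding laplacian_def
  proof (rule sum.cong[OF refl])
    fix b :: 'a assume b: "b \<in> Basis"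
    have "partial_deriv b (partial_deriv b (partial_deriv h f)) x
      = partial_deriv b (partial_deriv h (partial_deriv b f)) x"
      by (rule partial_deriv_cong[OF U x]) (rule partial_deriv_commute[OF U s])
    also have "\<dots> = partial_deriv h (partial_deriv b (partial_deriv b f)) x"
      by (rule partial_deriv_commute[OF U smooth_fun_on_partial[OF s b] x])
    finally show "partial_deriv b (partial_deriv b (partial_deriv h f)) x
      = partial_deriv h (partial_deriv b (partial_deriv b f)) x" .
  qed
  also have "\<dots> = partial_deriv h (laplacian f) x"
    unfolding laplacian_def
    by (rule partial_deriv_sum[symmetric])
      (intro smooth_fun_on_differentiable[OF _ x] smooth_fun_on_partial s)
  also have "\<dots> = partial_deriv h (\<lambda>_. 0) x"
    using f by (intro partial_deriv_cong[OF U x]) (simp add: harmonic_on_def)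
  finally show "laplacian (partial_deriv h f) x = 0" by simp
qed

subsection \<open>The maximum principle\<close>

lemma second_partial_nonpos_at_max:
  assumes U: "open U" "smooth_fun_on U f" "x \<in> U" and V: "open V" "x \<in> V" "\<And>y. y \<in> V \<Longrightarrow> f y \<le> f x"
  shows "partial_deriv b (partial_deriv b f) x \<le> 0"
proof (rule ccontr)
  assume "\<not> ?thesis"
  then have pos: "partial_deriv b (partial_deriv b f) x > 0" by simp
  obtain e where e: "e > 0" "ball x e \<subseteq> U \<inter> V" using U V by (meson IntI open_Int openE)
  let ?g = "\<lambda>t. f (x + t *\<^sub>R b)" and ?g' = "\<lambda>t. partial_deriv b f (x + t *\<^sub>R b)"
  define d where "d = e / (norm b + 1)"
  have d: "d > 0" using e by (simp add: d_def add_nonneg_pos)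
  have inb: "x + t *\<^sub>R b \<in> U \<inter> V" if "\<bar>t\<bar> < d" for t
  proof -
    have "\<bar>t\<bar> * norm b \<le> \<bar>t\<bar> * (norm b + 1)" by (simp add: mult_left_mono)
    also have "\<dots> < e" using that by (simp add: d_def pos_less_divide_eq add_nonneg_pos)
    finally have "x + t *\<^sub>R b \<in> ball x e" by (simp add: dist_norm)
    with e show ?thesis by blast
  qed
  have g: "(?g has_real_derivative ?g' t) (at t)" if "\<bar>t\<bar> < d" for t
    using inb[OF that] by (intro has_real_derivative_along_line smooth_fun_on_differentiable[OF U(2)]) auto
  have g': "(?g' has_real_derivative partial_deriv b (partial_deriv b f) (x + 0 *\<^sub>R b)) (at 0)"
    using U(3) by (intro has_real_derivative_along_line
        smooth_fun_on_differentiable[OF smooth_fun_on_directional[OF U(1,2)]]) auto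
  have "?g' 0 = 0"
  proof (rule DERIV_local_max[OF g])
    show "\<forall>y. \<bar>0 - y\<bar> < d \<longrightarrow> ?g y \<le> ?g 0" using inb V(3) by auto
  qed (use d in auto)
  then obtain c where c: "c > 0" "\<And>t. 0 < t \<Longrightarrow> t < c \<Longrightarrow> ?g' t > 0"
    using DERIV_pos_inc_right[OF g'] pos by auto
  define s where "s = min (c/2) (d/2)"
  have s: "0 < s" "s < c" "s < d" using c d by (auto simp: s_def)
  have "?g 0 < ?g s"
  proof (rule DERIV_pos_imp_increasing_open[OF s(1)])
    show "\<exists>y. (?g has_real_derivative y) (at t) \<and> y > 0" if "0 < t" "t < s" for t
      using g[of t] c(2)[of t] that s by auto
    show "continuous_on {0..s} ?g"
      using s by (intro continuous_at_imp_continuous_on ballI DERIV_isCont[OF g]) auto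
  qed
  moreover have "?g s \<le> ?g 0" using V(3) inb[of s] s by auto
  ultimately show False by simp
qed

lemma partial_deriv_sq_dist:
  "partial_deriv b (\<lambda>y. inner (y - p) (y - p)) x = 2 * inner (x - p) b"
  by (rule partial_deriv_frechet) (auto intro!: derivative_eq_intros simp: inner_commute)

lemma smooth_fun_on_sq_dist: "open U \<Longrightarrow> smooth_fun_on U (\<lambda>y. inner (y - p) (y - p))"
proof -
  assume U: "open U"
  have "smooth_fun_on U (\<lambda>y. \<Sum>b\<in>Basis. (inner y b - inner p b) * (inner y b - inner p b))"
    by (intro smooth_fun_on_sum smooth_fun_on_mult smooth_fun_on_diff smooth_fun_on_inner
        smooth_fun_on_const U)
  moreover have "(\<lambda>y. inner (y - p) (y - p)) = (\<lambda>y. \<Sum>b\<in>Basis. (inner y b - inner p b) * (inner y b - inner p b))"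
    by (rule ext) (subst euclidean_inner, simp add: inner_diff_left)
  ultimately show ?thesis by simp
qed

lemma second_partial_sq_dist:
  assumes "b \<in> Basis"
  shows "partial_deriv b (partial_deriv b (\<lambda>y. inner (y - p) (y - p))) x = 2"
proof -
  have "partial_deriv b (\<lambda>y. inner (y - p) (y - p)) = (\<lambda>y. 2 * inner (y - p) b)"
    by (rule ext) (rule partial_deriv_sq_dist)
  moreover have "partial_deriv b (\<lambda>y. 2 * inner (y - p) b) x = 2"
    using assms by (intro partial_deriv_frechet[where f'="\<lambda>h. 2 * inner h b", THEN trans])
      (auto intro!: derivative_eq_intros)
  ultimately show ?thesis by simp
qed

lemma laplacian_sq_dist: "laplacian (\<lambda>y. inner (y - p) (y - p)) (x::'a::euclidean_space) = 2 * DIM('a)"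
  by (simp add: laplacian_def second_partial_sq_dist)

text \<open>
  At an interior maximum all second derivatives are nonpositive, which is impossible if the Laplacian
  is positive. Adding a small multiple of the squared distance from the centre reduces the case of a
  nonnegative Laplacian to that of a positive one.
\<close>

lemma maximum_principle:
  assumes U: "open U" "cball p r \<subseteq> U" "smooth_fun_on U g" and r: "r > 0"
    and sub: "\<And>x. x \<in> ball p r \<Longrightarrow> laplacian g x \<ge> 0"
    and bd: "\<And>x. x \<in> sphere p r \<Longrightarrow> g x \<le> M"
    and x: "x \<in> cball p r"
  shows "g x \<le> M"
proof (rule field_le_epsilon)
  fix \<epsilon> :: real assume "\<epsilon> > 0"
  \<comment> \<open>With this factor the added term equals \<open>\<epsilon>\<close> on the sphere.\<close>
  define d where "d = \<epsilon> / r\<^sup>2"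
  have d: "d > 0" using \<open>\<epsilon> > 0\<close> r by (simp add: d_def)
  let ?q = "\<lambda>y. d * inner (y - p) (y - p)"
  let ?G = "\<lambda>y. g y + ?q y"
  have q: "smooth_fun_on U ?q" by (intro smooth_fun_on_cmult smooth_fun_on_sq_dist U)
  have G: "smooth_fun_on U ?G" by (intro smooth_fun_on_add q U)
  have "continuous_on (cball p r) ?G"
    by (rule continuous_on_subset[OF smooth_fun_on_continuous_on[OF G] U(2)])
  then obtain z where z: "z \<in> cball p r" "\<And>y. y \<in> cball p r \<Longrightarrow> ?G y \<le> ?G z"
    using continuous_attains_sup[of "cball p r" ?G] r by auto
  have "z \<notin> ball p r"
  proof
    assume zb: "z \<in> ball p r"
    then have zU: "z \<in> U" using U(2) by auto
    have "laplacian ?G z \<le> 0"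
      unfolding laplacian_def
      by (intro sum_nonpos second_partial_nonpos_at_max[OF U(1) G zU open_ball zb] z(2)) auto
    moreover have "laplacian ?G z = laplacian g z + d * (2 * DIM('a))"
      by (simp add: laplacian_add[OF U(1,3) q zU] laplacian_sq_dist
          laplacian_cmult[OF U(1) smooth_fun_on_sq_dist[OF U(1)] zU])
    moreover have "d * (2 * DIM('a)) > 0" using d by simp
    ultimately show False using sub[OF zb] by linarith
  qed
  then have zs: "z \<in> sphere p r" using z(1) by auto
  then have "?q z = \<epsilon>" using r by (simp add: d_def dist_norm norm_minus_commute flip: power2_norm_eq_inner)
  then have "?G z \<le> M + \<epsilon>" using bd[OF zs] by simp
  moreover have "g x \<le> ?G x" using d by simp
  ultimately show "g x \<le> M + \<epsilon>" using z(2)[OF x] by linarith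
qed

subsection \<open>Bernstein's gradient estimate\<close>

text \<open>
  Bernstein's method. Let \<open>v = partial_deriv h u\<close> and let \<open>e = r\<^sup>2 - norm (x - p) ^ 2\<close>, which vanishes
  on the sphere. In the Laplacian of \<open>(e v)\<^sup>2\<close> the terms with derivatives of \<open>v\<close> complete to squares;
  the only negative contribution is a multiple of \<open>v\<^sup>2\<close>, which is at most \<open>norm h ^ 2\<close> times the squared
  gradient of \<open>u\<close>. The Laplacian of \<open>u\<^sup>2\<close> is twice that squared gradient, so adding \<open>lam u\<^sup>2\<close> for a
  suitable constant \<open>lam\<close> gives a subharmonic function. It is bounded by \<open>lam M\<^sup>2\<close> on the sphere, hence
  at \<open>p\<close> as well.
\<close>

lemma harmonic_gradient_estimate:
  fixes u :: "'a::euclidean_space \<Rightarrow> real"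
  assumes U: "open U" "cball p r \<subseteq> U" "harmonic_on U u" and r: "r > 0"
    and bd: "\<And>x. x \<in> cball p r \<Longrightarrow> \<bar>u x\<bar> \<le> M"
  shows "\<bar>partial_deriv h u p\<bar> \<le> sqrt (2 * DIM('a) + 12) * norm h / r * M"
proof -
  \<comment> \<open>
    Chosen so that \<open>2 * lam * |grad u|\<^sup>2\<close> absorbs \<open>(24 * r\<^sup>2 + 4 * r\<^sup>2 * DIM('a)) * v\<^sup>2\<close> below.
  \<close>
  define lam where "lam = (2 * real DIM('a) + 12) * r\<^sup>2 * (norm h)\<^sup>2"
  have lam0: "lam \<ge> 0" by (simp add: lam_def)
  let ?v = "partial_deriv h u"
  let ?e = "\<lambda>y. r\<^sup>2 - inner (y - p) (y - p)"
  let ?w = "\<lambda>y. ?e y * ?v y"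
  let ?g = "\<lambda>y. ?w y * ?w y + lam * (u y * u y)"
  have su: "smooth_fun_on U u" using U(3) by (simp add: harmonic_on_def)
  have hv: "harmonic_on U ?v" by (rule harmonic_on_directional[OF U(1,3)])
  then have sv: "smooth_fun_on U ?v" by (simp add: harmonic_on_def)
  have se: "smooth_fun_on U ?e" by (intro smooth_fun_on_diff smooth_fun_on_const smooth_fun_on_sq_dist U)
  have sw: "smooth_fun_on U ?w" by (intro smooth_fun_on_mult U se sv)
  have suu: "smooth_fun_on U (\<lambda>y. u y * u y)" by (intro smooth_fun_on_mult U su)
  have sg: "smooth_fun_on U ?g"
    by (intro smooth_fun_on_add smooth_fun_on_mult smooth_fun_on_cmult U sw su)
  have e1: "partial_deriv b ?e x = - 2 * inner (x - p) b" for b x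
    by (rule partial_deriv_frechet) (auto intro!: derivative_eq_intros simp: inner_commute)
  have le: "laplacian ?e x = - 2 * real DIM('a)" if "x \<in> U" for x
    using laplacian_add[OF U(1) smooth_fun_on_const[OF U(1)] smooth_fun_on_cmult[OF U(1) smooth_fun_on_sq_dist[OF U(1)]] that,
        of "r\<^sup>2" "-1" p] laplacian_cmult[OF U(1) smooth_fun_on_sq_dist[OF U(1)] that, of "-1" p]
    by (simp add: laplacian_const laplacian_sq_dist)
  have sub: "laplacian ?g x \<ge> 0" if xb: "x \<in> ball p r" for x
  proof -
    have x: "x \<in> U" using xb U(2) by auto
    have u0: "laplacian u x = 0" and v0: "laplacian ?v x = 0"
      using U(3) hv x by (auto simp: harmonic_on_def)
    define E where "E = ?e x"
    define V where "V = ?v x"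
    define a where "a b = partial_deriv b ?e x" for b
    define c where "c b = partial_deriv b ?v x" for b
    define du where "du b = partial_deriv b u x" for b
    have nx: "norm (x - p) < r" using xb by (simp add: dist_norm norm_minus_commute)
    have nx2: "inner (x - p) (x - p) \<le> r\<^sup>2"
      using power_mono[of "norm (x - p)" r 2] nx by (simp flip: power2_norm_eq_inner)
    have E: "0 \<le> E" "E \<le> r\<^sup>2" using nx2 by (auto simp: E_def)
    have w1: "partial_deriv b ?w x = E * c b + a b * V" for b
      unfolding E_def c_def a_def V_def by (rule partial_deriv_mult_smooth[OF se sv x])
    have wl: "laplacian ?w x = 2 * (\<Sum>b\<in>Basis. a b * c b) - 2 * real DIM('a) * V"
      using laplacian_mult[OF U(1) se sv x] v0 le[OF x] by (simp add: a_def c_def V_def)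
    have "laplacian ?g x = laplacian (\<lambda>y. ?w y * ?w y) x + lam * laplacian (\<lambda>y. u y * u y) x"
      by (subst laplacian_add[OF U(1) smooth_fun_on_mult[OF U(1) sw sw] smooth_fun_on_cmult[OF U(1) suu] x])
        (simp add: laplacian_cmult[OF U(1) suu x])
    also have "laplacian (\<lambda>y. u y * u y) x = 2 * (\<Sum>b\<in>Basis. (du b)\<^sup>2)"
      by (simp add: laplacian_mult[OF U(1) su su x] u0 du_def power2_eq_square)
    also have "laplacian (\<lambda>y. ?w y * ?w y) x
       = 2 * (E * V * laplacian ?w x) + 2 * (\<Sum>b\<in>Basis. (E * c b + a b * V)\<^sup>2)"
      unfolding laplacian_mult[OF U(1) sw sw x] w1 E_def V_def
      by (simp add: power2_eq_square[of "_ + _"])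
    also have "2 * (E * V * laplacian ?w x) + 2 * (\<Sum>b\<in>Basis. (E * c b + a b * V)\<^sup>2)
       = 2 * (\<Sum>b\<in>Basis. (E * c b + 2 * a b * V)\<^sup>2) - 6 * V\<^sup>2 * (\<Sum>b\<in>Basis. (a b)\<^sup>2) - 4 * E * real DIM('a) * V\<^sup>2"
    proof -
      \<comment> \<open>Used with \<open>k = 1\<close> for the squares that occur and with \<open>k = 2\<close> for those that absorb the cross
        terms.\<close>
      have sq: "(\<Sum>b\<in>Basis. (E * c b + k * a b * V)\<^sup>2)
        = E\<^sup>2 * (\<Sum>b\<in>Basis. (c b)\<^sup>2) + 2 * k * E * V * (\<Sum>b\<in>Basis. a b * c b) + k\<^sup>2 * V\<^sup>2 * (\<Sum>b\<in>Basis. (a b)\<^sup>2)" for k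
        by (simp add: power2_eq_square algebra_simps sum.distrib sum_distrib_left)
      show ?thesis unfolding wl using sq[of 1] sq[of 2]
        by (simp add: algebra_simps power2_eq_square[of V])
    qed
    also have "(\<Sum>b\<in>Basis. (a b)\<^sup>2) = 4 * inner (x - p) (x - p)"
      unfolding a_def e1 by (subst euclidean_inner)
        (simp add: power_mult_distrib sum_distrib_left power2_eq_square)
    finally have L: "laplacian ?g x = 2 * (\<Sum>b\<in>Basis. (E * c b + 2 * a b * V)\<^sup>2)
       - (24 * inner (x - p) (x - p) + 4 * E * real DIM('a)) * V\<^sup>2 + 2 * lam * (\<Sum>b\<in>Basis. (du b)\<^sup>2)"
      by (simp add: algebra_simps)
    have "V = (\<Sum>b\<in>Basis. inner h b * du b)"
      unfolding V_def du_def
      by (rule partial_deriv_basis_expansion[OF smooth_fun_on_differentiable[OF su x]])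
    then have "V\<^sup>2 \<le> (\<Sum>b\<in>Basis. (inner h b)\<^sup>2) * (\<Sum>b\<in>Basis. (du b)\<^sup>2)"
      by (simp add: Cauchy_Schwarz_ineq_sum)
    also have "(\<Sum>b\<in>Basis. (inner h b)\<^sup>2) = (norm h)\<^sup>2"
      unfolding power2_norm_eq_inner by (subst euclidean_inner) (simp add: power2_eq_square)
    finally have CS: "V\<^sup>2 \<le> (norm h)\<^sup>2 * (\<Sum>b\<in>Basis. (du b)\<^sup>2)" .
    have "(24 * inner (x - p) (x - p) + 4 * E * real DIM('a)) * V\<^sup>2
      \<le> (24 * r\<^sup>2 + 4 * r\<^sup>2 * real DIM('a)) * V\<^sup>2"
      using nx2 E by (intro mult_right_mono add_mono) auto
    also have "\<dots> \<le> (24 * r\<^sup>2 + 4 * r\<^sup>2 * real DIM('a)) * ((norm h)\<^sup>2 * (\<Sum>b\<in>Basis. (du b)\<^sup>2))"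
      by (rule mult_left_mono[OF CS]) simp
    also have "\<dots> = 2 * lam * (\<Sum>b\<in>Basis. (du b)\<^sup>2)"
      by (simp add: lam_def algebra_simps)
    finally have "(24 * inner (x - p) (x - p) + 4 * E * real DIM('a)) * V\<^sup>2
      \<le> 2 * lam * (\<Sum>b\<in>Basis. (du b)\<^sup>2)" .
    moreover have "(\<Sum>b\<in>Basis. (E * c b + 2 * a b * V)\<^sup>2) \<ge> 0" by (simp add: sum_nonneg)
    ultimately show ?thesis unfolding L by linarith
  qed
  have uM: "u x * u x \<le> M\<^sup>2" if "x \<in> cball p r" for x
    using bd[OF that] abs_le_square_iff[of "u x" M] by (simp add: power2_eq_square)
  have M0: "M \<ge> 0" using bd[of p] r by auto
  have "?g p \<le> lam * M\<^sup>2"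
  proof (rule maximum_principle[OF U(1,2) sg r sub])
    fix x assume x: "x \<in> sphere p r"
    then have "?e x = 0" by (simp add: dist_norm norm_minus_commute flip: power2_norm_eq_inner)
    moreover have "lam * (u x * u x) \<le> lam * M\<^sup>2" using uM[of x] x lam0 by (intro mult_left_mono) auto
    ultimately show "?g x \<le> lam * M\<^sup>2" by simp
  qed (use r in auto)
  moreover have "?g p \<ge> (r\<^sup>2 * ?v p)\<^sup>2" using lam0 by (simp add: power2_eq_square)
  ultimately have "(r\<^sup>2 * ?v p)\<^sup>2 \<le> lam * M\<^sup>2" by linarith
  also have "lam * M\<^sup>2 = (sqrt (2 * DIM('a) + 12) * r * norm h * M)\<^sup>2"
    by (simp add: lam_def power_mult_distrib)
  finally have "\<bar>r\<^sup>2 * ?v p\<bar> \<le> \<bar>sqrt (2 * DIM('a) + 12) * r * norm h * M\<bar>"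
    by (simp only: abs_le_square_iff)
  also have "\<dots> = sqrt (2 * DIM('a) + 12) * r * norm h * M" using r M0 by simp
  finally show ?thesis using r by (simp add: abs_mult field_simps power2_eq_square)
qed

subsection \<open>Strong unique continuation for harmonic functions\<close>

lemma harmonic_on_iterated_directional:
  "open U \<Longrightarrow> harmonic_on U u \<Longrightarrow> harmonic_on U ((partial_deriv h ^^ k) u)"
  by (induction k) (auto intro: harmonic_on_directional)

text \<open>
  The gradient estimate is applied \<open>j\<close> times, each time on a ball of radius \<open>R / k\<close>, so that \<open>k\<close> steps
  use up only half of the radius \<open>2 R\<close>. The resulting growth \<open>k ^ k\<close> of the \<open>k\<close>-th derivative is slow
  enough for Taylor's theorem, by the next lemma.
\<close>

lemma harmonic_iterated_derivative_estimate:
  fixes u :: "'a::euclidean_space \<Rightarrow> real" and p h :: 'a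
  assumes U: "open U" "cball p (2 * R) \<subseteq> U" "harmonic_on U u" and R: "R > 0" and k: "k > 0"
    and bd: "\<And>x. x \<in> cball p (2 * R) \<Longrightarrow> \<bar>u x\<bar> \<le> M"
    and j: "j \<le> k" and x: "x \<in> cball p (2 * R - real j * (R / real k))"
  shows "\<bar>(partial_deriv h ^^ j) u x\<bar> \<le> (sqrt (2 * DIM('a) + 12) * norm h * real k / R) ^ j * M"
  using j x
proof (induction j arbitrary: x)
  case 0
  then show ?case using bd by simp
next
  case (Suc j)
  let ?C = "sqrt (2 * DIM('a) + 12) * norm h * real k / R"
  have rk: "R / real k > 0" using R k by simp
  have sub: "cball x (R / real k) \<subseteq> cball p (2 * R - real j * (R / real k))"
  proof
    fix y assume "y \<in> cball x (R / real k)"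
    then show "y \<in> cball p (2 * R - real j * (R / real k))"
      using Suc.prems(2) dist_triangle[of p y x] by (simp add: algebra_simps add_divide_distrib)
  qed
  also have "\<dots> \<subseteq> cball p (2 * R)" using R by (intro subset_cball) simp
  finally have subU: "cball x (R / real k) \<subseteq> U" using U(2) by blast
  have "\<bar>partial_deriv h ((partial_deriv h ^^ j) u) x\<bar>
    \<le> sqrt (2 * DIM('a) + 12) * norm h / (R / real k) * (?C ^ j * M)"
    by (rule harmonic_gradient_estimate[OF U(1) subU harmonic_on_iterated_directional[OF U(1,3)] rk])
      (use Suc sub in auto)
  then show ?case by (simp add: mult.assoc)
qed

lemma power_self_le_exp_fact: "real k ^ k / fact k \<le> exp 1 ^ k"
proof -
  have "(\<Sum>n\<in>{k}. real k ^ n /\<^sub>R fact n) \<le> (\<Sum>n. real k ^ n /\<^sub>R fact n)"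
    by (rule sum_le_suminf[OF summable_exp_generic]) auto
  then have "real k ^ k / fact k \<le> exp (real k)"
    unfolding exp_def by (simp add: field_simps)
  then show ?thesis using exp_of_nat_mult[of k "1::real"] by simp
qed

text \<open>
  Harmonic functions are real analytic. Along a segment from \<open>p\<close> to \<open>x = p + h\<close> the Taylor polynomial
  at \<open>p\<close> vanishes, and the remainder of order \<open>k\<close> is at most \<open>(C * norm h * exp 1 / R) ^ k * M\<close>, which
  tends to zero as soon as \<open>norm h\<close> is at most the radius \<open>\<rho>\<close> chosen below.
\<close>

lemma harmonic_zero_near_flat_point:
  fixes u :: "'a::euclidean_space \<Rightarrow> real"
  assumes U: "open U" "p \<in> U" "harmonic_on U u"
    and flat: "\<And>h k. (partial_deriv h ^^ k) u p = 0"
  shows "\<exists>\<rho>>0. ball p \<rho> \<subseteq> U \<and> (\<forall>x\<in>ball p \<rho>. u x = 0)"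
proof -
  obtain e where e: "e > 0" "cball p e \<subseteq> U" using U open_contains_cball by blast
  define R where "R = e / 2"
  have R: "R > 0" "cball p (2 * R) \<subseteq> U" using e by (auto simp: R_def)
  have su: "smooth_fun_on U u" using U by (simp add: harmonic_on_def)
  have "compact (u ` cball p (2 * R))"
    by (intro compact_continuous_image continuous_on_subset[OF smooth_fun_on_continuous_on[OF su]] R) auto
  then obtain M where M: "\<And>x. x \<in> cball p (2 * R) \<Longrightarrow> \<bar>u x\<bar> \<le> M"
    using compact_imp_bounded bounded_iff by (metis image_eqI real_norm_def)
  have M0: "M \<ge> 0" using M[of p] R by auto
  define C where "C = sqrt (2 * DIM('a) + 12)"
  have C: "C > 0" by (simp add: C_def add_nonneg_pos)
  \<comment> \<open>The second bound makes \<open>C * norm h * exp 1 / R\<close> at most one half.\<close>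
  define \<rho> where "\<rho> = min R (R / (2 * C * exp 1))"
  have \<rho>: "\<rho> > 0" "\<rho> \<le> R" "\<rho> * (2 * C * exp 1) \<le> R"
  proof -
    have "\<rho> \<le> R / (2 * C * exp 1)" by (simp add: \<rho>_def)
    then show "\<rho> * (2 * C * exp 1) \<le> R" using C by (simp add: pos_le_divide_eq)
  qed (use R C in \<open>auto simp: \<rho>_def\<close>)
  have "u x = 0" if x: "x \<in> ball p \<rho>" for x
  proof -
    define h where "h = x - p"
    have h: "norm h \<le> \<rho>" using x by (simp add: h_def dist_norm norm_minus_commute)
    have inb: "p + t *\<^sub>R h \<in> cball p R" if "0 \<le> t" "t \<le> 1" for t
    proof -
      have "t * norm h \<le> 1 * norm h" using that by (intro mult_right_mono) auto
      then show ?thesis using h \<rho> that by (simp add: dist_norm)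
    qed
    have le: "\<bar>u x\<bar> \<le> (1 / 2) ^ k * M" if k: "k > 0" for k
    proof -
      let ?D = "\<lambda>m t. (partial_deriv h ^^ m) u (p + t *\<^sub>R h)"
      have "\<exists>t. 0 < t \<and> t < 1 \<and> u (p + 1 *\<^sub>R h) = (\<Sum>m<k. ?D m 0 / fact m * 1 ^ m) + ?D k t / fact k * 1 ^ k"
      proof (rule Maclaurin[OF _ k])
        show "\<forall>m t. m < k \<and> 0 \<le> t \<and> t \<le> 1 \<longrightarrow> (?D m has_real_derivative ?D (Suc m) t) (at t)"
        proof (intro allI impI)
          fix m t assume mt: "m < k \<and> 0 \<le> t \<and> t \<le> (1::real)"
          have "cball p R \<subseteq> U" using R by (auto simp: subset_iff)
          then have "p + t *\<^sub>R h \<in> U" using inb[of t] mt by blast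
          moreover have "smooth_fun_on U ((partial_deriv h ^^ m) u)"
            using harmonic_on_iterated_directional[OF U(1,3)] by (simp add: harmonic_on_def)
          ultimately show "(?D m has_real_derivative ?D (Suc m) t) (at t)"
            using has_real_derivative_along_line smooth_fun_on_differentiable by fastforce
        qed
      qed auto
      then obtain t where t: "0 < t" "t < 1" "u x = ?D k t / fact k"
        using flat by (auto simp: h_def)
      have "\<bar>?D k t\<bar> \<le> (C * norm h * real k / R) ^ k * M"
        unfolding C_def
        by (rule harmonic_iterated_derivative_estimate[OF U(1) R(2) U(3) R(1) k M])
          (use inb[of t] t k in auto)
      then have "\<bar>u x\<bar> \<le> (C * norm h * real k / R) ^ k * M / fact k"
        by (simp add: t(3) divide_right_mono)
      also have "\<dots> = (C * norm h / R) ^ k * M * (real k ^ k / fact k)"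
        by (simp add: power_mult_distrib power_divide)
      also have "\<dots> \<le> (C * norm h / R) ^ k * M * exp 1 ^ k"
        using C R M0 by (intro mult_left_mono power_self_le_exp_fact) auto
      also have "\<dots> = (C * norm h / R * exp 1) ^ k * M"
        by (subst power_mult_distrib) (simp only: mult_ac)
      also have "\<dots> \<le> (1 / 2) ^ k * M"
      proof (intro mult_right_mono power_mono M0)
        have "2 * (C * norm h * exp 1) = norm h * (2 * C * exp 1)" by simp
        also have "\<dots> \<le> \<rho> * (2 * C * exp 1)" using C by (intro mult_right_mono h) auto
        also have "\<dots> \<le> R" by (rule \<rho>)
        finally show "C * norm h / R * exp 1 \<le> 1 / 2" using R by (simp add: field_simps)
      qed (use C R in auto)
      finally show ?thesis .
    qed
    have "(\<lambda>k. (1 / 2) ^ k * M) \<longlonglongrightarrow> 0"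
      by (intro tendsto_mult_left_zero LIMSEQ_realpow_zero) auto
    then have "\<bar>u x\<bar> \<le> 0"
      by (rule LIMSEQ_le_const) (use le in \<open>auto intro: exI[of _ 1]\<close>)
    then show ?thesis by simp
  qed
  moreover have "ball p \<rho> \<subseteq> U" using \<rho> R by (auto simp: subset_iff)
  ultimately show ?thesis using \<rho> by blast
qed

lemma iter_partial_linear_combination:
  assumes U: "open U" "x \<in> U" and f: "\<And>i. i \<in> I \<Longrightarrow> smooth_fun_on U (f i)" and bs: "bs \<in> lists Basis"
  shows "iter_partial bs (\<lambda>y. \<Sum>i\<in>I. c i * f i y) x = (\<Sum>i\<in>I. c i * iter_partial bs (f i) x)"
  using bs U(2)
proof (induction bs arbitrary: x)
  case Nil
  then show ?case by simp
next
  case (Cons b bs)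
  have d: "iter_partial bs (f i) differentiable (at x)" if "i \<in> I" for i
    using f[OF that] Cons by (auto simp: smooth_fun_on_def)
  have "partial_deriv b (iter_partial bs (\<lambda>y. \<Sum>i\<in>I. c i * f i y)) x
    = partial_deriv b (\<lambda>y. \<Sum>i\<in>I. c i * iter_partial bs (f i) y) x"
    using Cons by (intro partial_deriv_cong[OF U(1)]) auto
  also have "\<dots> = (\<Sum>i\<in>I. c i * partial_deriv b (iter_partial bs (f i)) x)"
    using d by (simp add: partial_deriv_sum partial_deriv_cmult)
  finally show ?case by simp
qed

text \<open>
  The induction carries the vanishing of all iterated partial derivatives of the \<open>k\<close>-th directional
  derivative; the step expands one directional derivative in the basis and appends the basis vector
  to the list.
\<close>

lemma flat_directional_derivatives:
  assumes U: "open U" "x \<in> U" and f: "smooth_fun_on U f"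
    and flat: "\<And>bs. bs \<in> lists Basis \<Longrightarrow> iter_partial bs f x = 0"
  shows "(partial_deriv h ^^ k) f x = 0"
proof -
  have "smooth_fun_on U ((partial_deriv h ^^ k) f) \<and> (\<forall>bs\<in>lists Basis. iter_partial bs ((partial_deriv h ^^ k) f) x = 0)"
  proof (induction k)
    case 0
    then show ?case using f flat by simp
  next
    case (Suc k)
    let ?g = "(partial_deriv h ^^ k) f"
    have g: "smooth_fun_on U ?g" using Suc by simp
    have "iter_partial bs (partial_deriv h ?g) x = 0" if bs: "bs \<in> lists Basis" for bs
    proof -
      have "iter_partial bs (partial_deriv h ?g) x
        = iter_partial bs (\<lambda>y. \<Sum>b\<in>Basis. inner h b * partial_deriv b ?g y) x"
        by (rule iter_partial_cong[OF U(1) _ U(2)])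
          (rule partial_deriv_basis_expansion[OF smooth_fun_on_differentiable[OF g]])
      also have "\<dots> = (\<Sum>b\<in>Basis. inner h b * iter_partial bs (partial_deriv b ?g) x)"
        by (rule iter_partial_linear_combination[OF U smooth_fun_on_partial[OF g] bs])
      also have "\<dots> = (\<Sum>b\<in>Basis. inner h b * iter_partial (bs @ [b]) ?g x)"
        by (simp only: iter_partial_snoc)
      also have "\<dots> = 0" using Suc bs by (intro sum.neutral) auto
      finally show ?thesis .
    qed
    then show ?case using smooth_fun_on_directional[OF U(1) g] by simp
  qed
  then show ?thesis by (metis iter_partial_Nil lists.Nil)
qed

text \<open>
  The set of points at which all iterated derivatives vanish is closed in \<open>U\<close> by continuity and open by
  \<open>harmonic_zero_near_flat_point\<close>.
\<close>

lemma harmonic_strong_unique_continuation: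
  assumes U: "open U" "connected U" "harmonic_on U u" and p: "p \<in> U"
    and flat: "\<And>bs. bs \<in> lists Basis \<Longrightarrow> iter_partial bs u p = 0"
    and x: "x \<in> U"
  shows "u x = 0"
proof -
  let ?S = "{y \<in> U. \<forall>bs\<in>lists Basis. iter_partial bs u y = 0}"
  have su: "smooth_fun_on U u" using U by (simp add: harmonic_on_def)
  have "open ?S"
    unfolding open_contains_ball
  proof
    fix y assume y: "y \<in> ?S"
    then obtain \<rho> where \<rho>: "\<rho> > 0" "ball y \<rho> \<subseteq> U" "\<And>z. z \<in> ball y \<rho> \<Longrightarrow> u z = 0"
      using harmonic_zero_near_flat_point[OF U(1) _ U(3), of y]
        flat_directional_derivatives[OF U(1) _ su, of y] by auto
    have "iter_partial bs u z = 0" if z: "z \<in> ball y \<rho>" for bs z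
    proof -
      have "iter_partial bs (\<lambda>_. 0) z = (0::real)" 
      proof (induction bs arbitrary: z)
        case (Cons b bs)
        then have "iter_partial bs (\<lambda>_::'a. 0) = (\<lambda>_. 0)" by auto
        then show ?case by simp
      qed simp
      then show ?thesis using iter_partial_cong[OF open_ball \<rho>(3) z] by simp
    qed
    then show "\<exists>e>0. ball y e \<subseteq> ?S" using \<rho> by blast
  qed
  moreover have "closedin (top_of_set U) ?S"
  proof -
    have "?S = U \<inter> (\<Inter>bs\<in>lists Basis. {y \<in> U. iter_partial bs u y = 0})" by auto
    also have "closedin (top_of_set U) \<dots>"
      by (intro closedin_Int closedin_INT continuous_closedin_preimage_constant
          smooth_fun_on_continuous_on smooth_fun_on_iter_partial su)
        (auto simp: ex_in_conv[symmetric])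
    finally show ?thesis .
  qed
  moreover have "?S \<subseteq> U" by auto
  ultimately have "?S = {} \<or> ?S = U"
    using U(2) by (meson connected_clopen open_subset)
  moreover have "p \<in> ?S" using p flat by simp
  ultimately have "x \<in> ?S" using x by (metis (no_types, lifting) empty_iff)
  then have "iter_partial [] u x = 0" by blast
  then show ?thesis by simp
qed

section \<open>A smooth function with prescribed closed zero set\<close>

definition bump :: "'a::euclidean_space \<Rightarrow> real \<Rightarrow> 'a \<Rightarrow> real" where
  "bump a r x = flat_exp 0 (r\<^sup>2 - inner (x - a) (x - a))"

lemma smooth_fun_on_bump: "open U \<Longrightarrow> smooth_fun_on U (bump a r)"
  unfolding bump_def[abs_def]
  by (intro smooth_fun_on_flat_exp smooth_fun_on_diff smooth_fun_on_const smooth_fun_on_sq_dist)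

lemma bump_nonneg: "bump a r x \<ge> 0"
  by (simp add: bump_def flat_exp_def)

lemma bump_eq_0_iff:
  assumes "r \<ge> 0"
  shows "bump a r x = 0 \<longleftrightarrow> x \<notin> ball a r"
proof -
  have "r\<^sup>2 - inner (x - a) (x - a) > 0 \<longleftrightarrow> norm (x - a) < r"
    using assms power_strict_mono[of "norm (x - a)" r 2] power_less_imp_less_base[of "norm (x - a)" 2 r]
    by (auto simp: power2_norm_eq_inner[symmetric])
  then show ?thesis by (simp add: bump_def flat_exp_def dist_norm norm_minus_commute)
qed

lemma iter_partial_zero [simp]: "iter_partial bs (\<lambda>_. 0) = (\<lambda>_. 0)"
proof (induction bs)
  case (Cons b bs)
  then show ?case by (simp only: iter_partial_Cons) (simp add: fun_eq_iff)
qed simp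

lemma iter_partial_bump_bounded:
  assumes "r \<ge> 0" "bs \<in> lists Basis"
  shows "\<exists>B. \<forall>x. \<bar>iter_partial bs (bump a r) x\<bar> \<le> B"
proof -
  have "continuous_on UNIV (iter_partial bs (bump a r))"
    by (intro smooth_fun_on_continuous_on smooth_fun_on_iter_partial smooth_fun_on_bump assms) auto
  then have "compact (iter_partial bs (bump a r) ` cball a r)"
    by (intro compact_continuous_image) (auto intro: continuous_on_subset)
  then obtain B where B: "\<And>x. x \<in> cball a r \<Longrightarrow> \<bar>iter_partial bs (bump a r) x\<bar> \<le> B"
    using compact_imp_bounded bounded_iff by (metis image_eqI real_norm_def)
  have "iter_partial bs (bump a r) x = 0" if "x \<in> - cball a r" for x
  proof -
    have "bump a r y = 0" if "y \<in> - cball a r" for y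
      using that bump_eq_0_iff[OF assms(1), of a y] by auto
    then show ?thesis
      using iter_partial_cong[of "- cball a r" "bump a r" "\<lambda>_. 0" x bs] that by (simp add: open_Compl)
  qed
  then have "\<bar>iter_partial bs (bump a r) x\<bar> \<le> max B 0" for x
    using B[of x] by (cases "x \<in> cball a r") (auto simp: le_max_iff_disj)
  then show ?thesis by blast
qed

text \<open>
  The series of the derivatives of each order converges uniformly by the Weierstrass test. So the class
  of all these sums consists of differentiable functions and is closed under partial derivatives, and
  \<open>smooth_fun_on_coinduct\<close> applies.
\<close>

lemma smooth_fun_on_series:
  fixes g :: "nat \<Rightarrow> 'a::euclidean_space \<Rightarrow> real"
  assumes g: "\<And>k. smooth_fun_on UNIV (g k)"
    and bd: "\<And>bs. bs \<in> lists Basis \<Longrightarrow> \<exists>M. summable M \<and> (\<forall>k x. \<bar>iter_partial bs (g k) x\<bar> \<le> M k)"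
  shows "smooth_fun_on UNIV (\<lambda>x. \<Sum>k. g k x)"
proof -
  define S where "S bs x = (\<Sum>k. iter_partial bs (g k) x)" for bs x
  have lim: "uniform_limit UNIV (\<lambda>n x. \<Sum>k<n. iter_partial bs (g k) x) (S bs) sequentially"
    if bs: "bs \<in> lists Basis" for bs
  proof -
    obtain M where "summable M" "\<forall>k x. \<bar>iter_partial bs (g k) x\<bar> \<le> M k" using bd[OF bs] by blast
    then show ?thesis unfolding S_def by (intro Weierstrass_m_test) auto
  qed
  have sums: "(\<lambda>k. iter_partial bs (g k) x) sums S bs x" if "bs \<in> lists Basis" for bs x
    using tendsto_uniform_limitI[OF lim[OF that], of x] by (simp add: sums_def)
  have der: "(S bs has_derivative (\<lambda>h. \<Sum>b\<in>Basis. inner h b * S (b # bs) x)) (at x)"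
    if bs: "bs \<in> lists Basis" for bs x
  proof -
    have "\<exists>G. \<forall>x\<in>UNIV. (\<lambda>n. iter_partial bs (g n) x) sums G x
      \<and> (G has_derivative (\<lambda>h. \<Sum>b\<in>Basis. inner h b * S (b # bs) x)) (at x within UNIV)"
    proof (rule has_derivative_series[where f' = "\<lambda>n x h. partial_deriv h (iter_partial bs (g n)) x"])
      have d: "iter_partial bs (g n) differentiable (at y)" for n y
        using g[of n] bs by (auto simp: smooth_fun_on_def)
      show "(iter_partial bs (g n) has_derivative (\<lambda>h. partial_deriv h (iter_partial bs (g n)) y)) (at y within UNIV)"
        for n y using has_derivative_partial[OF d] by simp
      fix e :: real assume "e > 0"
      define e' where "e' = e / DIM('a)"
      have e': "e' > 0" using \<open>e > 0\<close> by (simp add: e'_def)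
      have "\<forall>\<^sub>F n in sequentially. \<forall>b\<in>Basis. \<forall>y\<in>UNIV.
        dist (\<Sum>k<n. iter_partial (b # bs) (g k) y) (S (b # bs) y) < e'"
        using bs by (intro eventually_ball_finite ballI uniform_limitD[OF lim _] e') auto
      then show "\<forall>\<^sub>F n in sequentially. \<forall>y\<in>UNIV. \<forall>h. norm ((\<Sum>i<n. partial_deriv h (iter_partial bs (g i)) y)
          - (\<Sum>b\<in>Basis. inner h b * S (b # bs) y)) \<le> e * norm h"
      proof eventually_elim
        case (elim n)
        show ?case
        proof (intro ballI allI)
          fix y h
          have "(\<Sum>i<n. partial_deriv h (iter_partial bs (g i)) y) - (\<Sum>b\<in>Basis. inner h b * S (b # bs) y)
            = (\<Sum>b\<in>Basis. inner h b * ((\<Sum>i<n. iter_partial (b # bs) (g i) y) - S (b # bs) y))"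
            by (simp add: partial_deriv_basis_expansion[OF d, of h] sum.swap[of _ _ "{..<n}"]
                sum_distrib_left right_diff_distrib sum_subtractf)
          also have "norm \<dots> \<le> (\<Sum>b\<in>(Basis::'a set). norm h * e')"
          proof (rule sum_norm_le)
            fix b :: 'a assume b: "b \<in> Basis"
            show "norm (inner h b * ((\<Sum>i<n. iter_partial (b # bs) (g i) y) - S (b # bs) y)) \<le> norm h * e'"
              unfolding norm_mult
              using elim b Basis_le_norm[OF b, of h]
              by (intro mult_mono) (auto simp: dist_norm intro: less_imp_le)
          qed
          also have "\<dots> = e * norm h" by (simp add: e'_def)
          finally show "norm ((\<Sum>i<n. partial_deriv h (iter_partial bs (g i)) y)
            - (\<Sum>b\<in>Basis. inner h b * S (b # bs) y)) \<le> e * norm h" .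
        qed
      qed
    qed (use sums[OF bs] in auto)
    then obtain G where G: "\<And>y. (\<lambda>n. iter_partial bs (g n) y) sums G y"
      "\<And>y. (G has_derivative (\<lambda>h. \<Sum>b\<in>Basis. inner h b * S (b # bs) y)) (at y)" by auto
    have "G = S bs" by (rule ext) (rule sums_unique2[OF G(1) sums[OF bs]])
    with G(2) show ?thesis by simp
  qed
  have "smooth_fun_on UNIV (S [])"
  proof (rule smooth_fun_on_coinduct[where F = "S ` lists Basis"])
    show "G differentiable (at x)" if "G \<in> S ` lists Basis" for G x
      using der that unfolding differentiable_def by blast
    show "\<exists>H\<in>S ` lists Basis. \<forall>x\<in>UNIV. partial_deriv b G x = H x"
      if G: "G \<in> S ` lists Basis" and b: "b \<in> Basis" for G b
    proof -
      obtain bs where bs: "bs \<in> lists Basis" "G = S bs" using G by blast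
      have "partial_deriv b (S bs) x = S (b # bs) x" for x
        using b by (simp add: partial_deriv_frechet[OF der[OF bs(1)]] inner_Basis if_distrib[of "\<lambda>z. z * _"] cong: if_cong)
      then show ?thesis using bs b by (intro bexI[of _ "S (b # bs)"]) auto
    qed
  qed auto
  then show ?thesis by (simp add: S_def[abs_def])
qed

lemma iter_partial_cmult:
  assumes "smooth_fun_on UNIV f" "bs \<in> lists Basis"
  shows "iter_partial bs (\<lambda>y. c * f y) x = c * iter_partial bs f x"
  using iter_partial_linear_combination[OF open_UNIV UNIV_I, of "{()}" "\<lambda>_. f" bs "\<lambda>_. c" x] assms by simp

text \<open>
  The complement of \<open>A\<close> is a countable union of balls. Each ball is the set where a nonnegative bump
  function is positive, and the sum of the bump functions works once they are scaled so that the
  \<open>k\<close>-th one has all derivatives of order at most \<open>k\<close> bounded by \<open>2\<close> to the power \<open>- k\<close>.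
\<close>

lemma closed_is_smooth_zero_set:
  fixes A :: "'a::euclidean_space set"
  assumes "closed A"
  shows "\<exists>f. smooth_fun_on UNIV f \<and> (\<forall>x. f x = 0 \<longleftrightarrow> x \<in> A)"
proof -
  \<comment> \<open>Radius zero is admitted, so that the family contains the empty set and can be enumerated by all
    natural numbers even if \<open>A\<close> is the whole space.\<close>
  define F where "F = {ball x e |x e. e \<ge> 0 \<and> ball x e \<subseteq> - A}"
  obtain F' where F': "F' \<subseteq> F" "countable F'" "\<Union>F' = \<Union>F"
    using Lindelof[of F] by (auto simp: F_def)
  have UF: "\<Union>F = - A"
  proof
    show "- A \<subseteq> \<Union>F"
    proof
      fix x assume "x \<in> - A"
      then obtain e where "e > 0" "ball x e \<subseteq> - A" using assms by (meson open_Compl openE)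
      then show "x \<in> \<Union>F" by (auto simp: F_def intro!: exI[of _ "ball x e"] exI[of _ x] exI[of _ e])
    qed
  qed (auto simp: F_def)
  define T where "T = from_nat_into (insert {} F')"
  have rT: "range T = insert {} F'" unfolding T_def using F'(2) by (intro range_from_nat_into) auto
  have "{} \<in> F" by (auto simp: F_def intro!: exI[of _ 0])
  then have "range T \<subseteq> F" using rT F'(1) by simp
  have "\<forall>k. \<exists>c. snd c \<ge> 0 \<and> T k = ball (fst c) (snd c)"
  proof
    fix k
    have "T k \<in> F" using \<open>range T \<subseteq> F\<close> by blast
    then obtain x e where "T k = ball x e" "e \<ge> 0" unfolding F_def by auto
    then show "\<exists>c. snd c \<ge> 0 \<and> T k = ball (fst c) (snd c)" by (intro exI[of _ "(x, e)"]) simp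
  qed
  then obtain c where "\<forall>k. snd (c k) \<ge> 0 \<and> T k = ball (fst (c k)) (snd (c k))"
    by (rule choice[THEN exE])
  then obtain a r where ar: "\<And>k. r k \<ge> 0" "\<And>k. T k = ball (a k) (r k)"
    by (intro that[of "\<lambda>k. snd (c k)" "\<lambda>k. fst (c k)"]) auto
  have "(\<Union>k. ball (a k) (r k)) = \<Union>(range T)" by (simp add: ar(2))
  also have "\<dots> = - A" using F'(3) UF by (simp add: rT)
  finally have UT: "(\<Union>k. ball (a k) (r k)) = - A" .
  define \<beta> where "\<beta> k = bump (a k) (r k)" for k
  have \<beta>: "smooth_fun_on UNIV (\<beta> k)" for k by (simp add: \<beta>_def smooth_fun_on_bump)
  define B where "B k bs = (SOME b. \<forall>x. \<bar>iter_partial bs (\<beta> k) x\<bar> \<le> b)" for k bs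
  have B: "\<bar>iter_partial bs (\<beta> k) x\<bar> \<le> B k bs" if "bs \<in> lists Basis" for k bs x
    using someI_ex[OF iter_partial_bump_bounded[OF ar(1)[of k] that, of "a k"]]
    by (simp add: B_def \<beta>_def)
  have B0: "B k bs \<ge> 0" if "bs \<in> lists Basis" for k bs using B[OF that, of k 0] by simp
  define L where "L k = {bs::'a list. set bs \<subseteq> Basis \<and> length bs \<le> k}" for k
  have finL: "finite (L k)" for k unfolding L_def by (rule finite_lists_length_le) simp
  define c where "c k = (1 / 2) ^ k / (1 + (\<Sum>bs\<in>L k. B k bs))" for k
  have sB: "(\<Sum>bs\<in>L k. B k bs) \<ge> 0" for k
    by (rule sum_nonneg) (auto intro!: B0 simp: L_def)
  have c0: "c k > 0" for k using sB[of k] by (auto simp: c_def intro!: divide_pos_pos)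
  define g where "g k x = c k * \<beta> k x" for k x
  have gs: "smooth_fun_on UNIV (g k)" for k unfolding g_def[abs_def] by (intro smooth_fun_on_cmult \<beta>) simp
  have bd: "\<exists>M. summable M \<and> (\<forall>k x. \<bar>iter_partial bs (g k) x\<bar> \<le> M k)" if bs: "bs \<in> lists Basis" for bs
  proof (intro exI conjI allI)
    \<comment> \<open>The scaling controls derivatives of order at most \<open>k\<close> of the \<open>k\<close>-th term only; the finitely many
      earlier terms do not affect summability.\<close>
    let ?M = "\<lambda>k. if k < length bs then c k * B k bs else (1 / 2) ^ k"
    have "summable ?M \<longleftrightarrow> summable (\<lambda>k. (1 / 2 :: real) ^ k)"
      by (intro summable_cong eventually_sequentiallyI[of "length bs"]) auto
    then show "summable ?M" by (simp add: summable_geometric)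
    fix k x
    have "\<bar>iter_partial bs (g k) x\<bar> = c k * \<bar>iter_partial bs (\<beta> k) x\<bar>"
      using c0[of k] unfolding g_def[abs_def] by (simp add: iter_partial_cmult[OF \<beta> bs] abs_mult)
    also have "\<dots> \<le> c k * B k bs" using c0[of k] by (intro mult_left_mono B bs) simp
    finally have le: "\<bar>iter_partial bs (g k) x\<bar> \<le> c k * B k bs" .
    have "c k * B k bs \<le> (1 / 2) ^ k" if "\<not> k < length bs"
    proof -
      have "bs \<in> L k" using that bs by (auto simp: L_def)
      then have "B k bs \<le> (\<Sum>bs\<in>L k. B k bs)"
        by (intro member_le_sum finL B0) (auto simp: L_def)
      then have "c k * B k bs \<le> c k * (1 + (\<Sum>bs\<in>L k. B k bs))"
        using c0[of k] by (intro mult_left_mono) auto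
      also have "\<dots> = (1 / 2) ^ k" using sB[of k] by (simp add: c_def)
      finally show ?thesis .
    qed
    with le show "\<bar>iter_partial bs (g k) x\<bar> \<le> ?M k" by auto
  qed
  show ?thesis
  proof (intro exI conjI allI)
    show "smooth_fun_on UNIV (\<lambda>x. \<Sum>k. g k x)" by (rule smooth_fun_on_series[OF gs bd])
    fix x
    obtain M where M: "summable M" "\<And>k. \<bar>g k x\<bar> \<le> M k" using bd[OF lists.Nil] by auto
    have "summable (\<lambda>k. g k x)"
      by (rule summable_comparison_test'[OF M(1), of 0]) (simp add: M(2))
    moreover have g0: "g k x \<ge> 0" for k using c0[of k] by (simp add: g_def \<beta>_def bump_nonneg)
    ultimately have "(\<Sum>k. g k x) = 0 \<longleftrightarrow> (\<forall>k. g k x = 0)" by (rule suminf_eq_zero_iff)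
    also have "\<dots> \<longleftrightarrow> (\<forall>k. x \<notin> ball (a k) (r k))"
      using c0 by (simp add: g_def \<beta>_def bump_eq_0_iff[OF ar(1)] less_imp_neq[THEN not_sym] del: mem_ball)
    also have "\<dots> \<longleftrightarrow> x \<in> A" using UT by blast
    finally show "(\<Sum>k. g k x) = 0 \<longleftrightarrow> x \<in> A" .
  qed
qed

section \<open>Dirac operators\<close>

subsection \<open>Clifford matrices\<close>

text \<open>
  Representations of the Clifford algebra by real symmetric matrices. With \<open>b = c\<close> the second condition
  says that each matrix squares to the identity.
\<close>

definition clifford_family :: "'a set \<Rightarrow> nat \<Rightarrow> ('a \<Rightarrow> real mat) \<Rightarrow> bool" where
  "clifford_family I N A \<longleftrightarrow>
     (\<forall>b\<in>I. A b \<in> carrier_mat N N \<and> transpose_mat (A b) = A b) \<and>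
     (\<forall>b\<in>I. \<forall>c\<in>I. A b * A c + A c * A b = (if b = c then 2 \<cdot>\<^sub>m 1\<^sub>m N else 0\<^sub>m N N))"

lemma four_block_two_one: "four_block_mat (2 \<cdot>\<^sub>m 1\<^sub>m N) (0\<^sub>m N N) (0\<^sub>m N N) (2 \<cdot>\<^sub>m 1\<^sub>m N) = 2 \<cdot>\<^sub>m (1\<^sub>m (N + N) :: real mat)"
  by (rule eq_matI) auto

text \<open>
  Generators are adjoined one at a time by doubling the size: the old matrices \<open>A b\<close> become
  \<open>((0, A b), (A b, 0))\<close>, and the new one is \<open>((1, 0), (0, -1))\<close>.
\<close>

lemma clifford_family_exists:
  assumes "finite I"
  shows "\<exists>N A. N > 0 \<and> clifford_family I N A"
  using assms
proof (induction I rule: finite_induct)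
  case empty
  show ?case by (rule exI[of _ 1]) (simp add: clifford_family_def)
next
  case (insert x I)
  then obtain N A where N: "N > 0" and A: "clifford_family I N A" by blast
  define B where "B b = (if b = x then four_block_mat (1\<^sub>m N) (0\<^sub>m N N) (0\<^sub>m N N) (- 1\<^sub>m N)
    else four_block_mat (0\<^sub>m N N) (A b) (A b) (0\<^sub>m N N))" for b
  have mz: "- 0\<^sub>m N N = (0\<^sub>m N N :: real mat)" by (rule eq_matI) auto
  have c: "A b \<in> carrier_mat N N" if "b \<in> I" for b using A that by (simp add: clifford_family_def)
  have c': "A b \<in> carrier_mat N N" if "b \<in> insert x I" "b \<noteq> x" for b using c that by auto
  have Bc: "B b \<in> carrier_mat (N + N) (N + N)" if "b \<in> insert x I" for b
    using c'[OF that] by (auto simp: B_def)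
  have Bt: "transpose_mat (B b) = B b" if "b \<in> insert x I" for b
  proof (cases "b = x")
    case True
    have "transpose_mat (- 1\<^sub>m N) = (- 1\<^sub>m N :: real mat)" by (rule eq_matI) auto
    then show ?thesis using True
      by (simp add: B_def transpose_four_block_mat[of "1\<^sub>m N" N N "0\<^sub>m N N" N "0\<^sub>m N N" N "- 1\<^sub>m N"])
  next
    case False
    have "transpose_mat (A b) = A b" using A that False by (auto simp: clifford_family_def)
    then show ?thesis using False c'[OF that False]
      by (simp add: B_def transpose_four_block_mat[of "0\<^sub>m N N" N N "A b" N "A b" N "0\<^sub>m N N"])
  qed
  have Br: "B b * B d + B d * B b = (if b = d then 2 \<cdot>\<^sub>m 1\<^sub>m (N + N) else 0\<^sub>m (N + N) (N + N))"
    if bd: "b \<in> insert x I" "d \<in> insert x I" for b d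
  proof -
    have xx: "B x * B x + B x * B x = 2 \<cdot>\<^sub>m 1\<^sub>m (N + N)"
    proof -
      have "(- 1\<^sub>m N) * (- 1\<^sub>m N) = (1\<^sub>m N :: real mat)" by simp
      then have "B x * B x = four_block_mat (1\<^sub>m N) (0\<^sub>m N N) (0\<^sub>m N N) (1\<^sub>m N)"
        by (simp add: B_def mz mult_four_block_mat[of _ N N _ N _ N _ _ N _ N])
      then show ?thesis by (intro eq_matI) auto
    qed
    have xd: "B x * B d + B d * B x = 0\<^sub>m (N + N) (N + N) \<and> B d * B x + B x * B d = 0\<^sub>m (N + N) (N + N)"
      if d: "d \<in> I" "d \<noteq> x" for d
    proof -
      note cd = c[OF d(1)]
      have "B x * B d = four_block_mat (0\<^sub>m N N) (A d) (- A d) (0\<^sub>m N N)"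
        using cd d by (simp add: B_def mz mult_four_block_mat[of _ N N _ N _ N _ _ N _ N])
      moreover have "B d * B x = four_block_mat (0\<^sub>m N N) (- A d) (A d) (0\<^sub>m N N)"
        using cd d by (simp add: B_def mz mult_four_block_mat[of _ N N _ N _ N _ _ N _ N])
      ultimately show ?thesis using cd by (auto intro!: eq_matI)
    qed
    have bd': "B b * B d + B d * B b = (if b = d then 2 \<cdot>\<^sub>m 1\<^sub>m (N + N) else 0\<^sub>m (N + N) (N + N))"
      if b: "b \<in> I" "b \<noteq> x" and d: "d \<in> I" "d \<noteq> x" for b d
    proof -
      note cb = c[OF b(1)] and cd = c[OF d(1)]
      have 1: "B b * B d = four_block_mat (A b * A d) (0\<^sub>m N N) (0\<^sub>m N N) (A b * A d)"
        using cb cd b d by (simp add: B_def mz mult_four_block_mat[of _ N N _ N _ N _ _ N _ N])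
      have 2: "B d * B b = four_block_mat (A d * A b) (0\<^sub>m N N) (0\<^sub>m N N) (A d * A b)"
        using cb cd b d by (simp add: B_def mz mult_four_block_mat[of _ N N _ N _ N _ _ N _ N])
      have "B b * B d + B d * B b
        = four_block_mat (A b * A d + A d * A b) (0\<^sub>m N N) (0\<^sub>m N N) (A b * A d + A d * A b)"
        unfolding 1 2 using cb cd by (subst add_four_block_mat[of _ N N _ N _ N]) auto
      also have "A b * A d + A d * A b = (if b = d then 2 \<cdot>\<^sub>m 1\<^sub>m N else 0\<^sub>m N N)"
        using A b d by (simp add: clifford_family_def)
      finally show ?thesis by (simp add: four_block_two_one split: if_splits)
    qed
    show ?thesis
      using bd xx xd bd' by (cases "b = x"; cases "d = x") auto
  qed
  have "clifford_family (insert x I) (N + N) B"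
    unfolding clifford_family_def using Bc Bt Br by blast
  then show ?case using N by (intro exI[of _ "N + N"] exI[of _ B]) simp
qed

lemma mat_mult_entry:
  "P \<in> carrier_mat N N \<Longrightarrow> Q \<in> carrier_mat N N \<Longrightarrow> i < N \<Longrightarrow> j < N \<Longrightarrow>
   (P * Q) $$ (i, j) = (\<Sum>k<N. P $$ (i, k) * Q $$ (k, j))"
  by (simp add: scalar_prod_def lessThan_atLeast0)

lemma clifford_carrier: "clifford_family I N A \<Longrightarrow> b \<in> I \<Longrightarrow> A b \<in> carrier_mat N N"
  by (simp add: clifford_family_def)

lemma clifford_anticommute:
  assumes "clifford_family I N A" "b \<in> I" "c \<in> I" "i < N" "j < N"
  shows "(A b * A c) $$ (i, j) + (A c * A b) $$ (i, j) = (if b = c \<and> i = j then 2 else 0 :: real)"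
proof -
  note cc = clifford_carrier[OF assms(1,2)] clifford_carrier[OF assms(1,3)]
  have "(A b * A c + A c * A b) $$ (i, j) = (if b = c \<and> i = j then 2 else 0)"
    using assms by (simp add: clifford_family_def)
  then show ?thesis using cc assms(4,5) by simp
qed

lemma clifford_square:
  assumes "clifford_family I N A" "b \<in> I"
  shows "A b * A b = 1\<^sub>m N"
proof (rule eq_matI)
  fix i j assume "i < dim_row (1\<^sub>m N :: real mat)" "j < dim_col (1\<^sub>m N :: real mat)"
  then show "(A b * A b) $$ (i, j) = 1\<^sub>m N $$ (i, j)"
    using clifford_anticommute[OF assms assms(2), of i j] by (auto split: if_splits)
qed (use clifford_carrier[OF assms] in auto)

text \<open>
  By symmetry and anticommutation, the product of two distinct generators is skew symmetric.
\<close>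

lemma clifford_product_diagonal:
  assumes A: "clifford_family I N A" "b \<in> I" "c \<in> I" "b \<noteq> c" and i: "i < N"
  shows "(A b * A c) $$ (i, i) = 0"
proof -
  note cc = clifford_carrier[OF A(1,2)] clifford_carrier[OF A(1,3)]
  have "transpose_mat (A b * A c) = A c * A b"
    using A cc by (simp add: transpose_mult[OF cc] clifford_family_def)
  moreover have "transpose_mat (A b * A c) $$ (i, i) = (A b * A c) $$ (i, i)"
    using cc i by simp
  ultimately show ?thesis
    using clifford_anticommute[OF A(1-3) i i] A(4) by simp
qed

text \<open>
  Only the symmetric part of the products \<open>A b * A c\<close> contributes, and that part is the identity or
  zero. With \<open>H\<close> the second derivatives this gives the square of the Dirac operator, with
  \<open>H b c l = inner \<xi> b * inner \<xi> c\<close> for one \<open>l\<close>, and zero otherwise, the square of its symbol.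
\<close>

lemma clifford_contraction:
  fixes H :: "'a::euclidean_space \<Rightarrow> 'a \<Rightarrow> nat \<Rightarrow> real"
  assumes A: "clifford_family Basis N A" and i: "i < N"
    and H: "\<And>b c l. b \<in> Basis \<Longrightarrow> c \<in> Basis \<Longrightarrow> l < N \<Longrightarrow> H b c l = H c b l"
  shows "(\<Sum>b\<in>Basis. \<Sum>c\<in>Basis. \<Sum>l<N. (A b * A c) $$ (i, l) * H b c l) = (\<Sum>b\<in>Basis. H b b i)"
    (is "?L = _")
proof -
  have "?L = (\<Sum>b\<in>Basis. \<Sum>c\<in>Basis. \<Sum>l<N. (A c * A b) $$ (i, l) * H b c l)"
    by (subst sum.swap) (auto intro!: sum.cong simp: H)
  then have "2 * ?L = (\<Sum>b\<in>Basis. \<Sum>c\<in>Basis. \<Sum>l<N. ((A b * A c) $$ (i, l) + (A c * A b) $$ (i, l)) * H b c l)"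
    by (simp add: sum.distrib distrib_right)
  also have "\<dots> = (\<Sum>b\<in>Basis. \<Sum>c\<in>Basis. \<Sum>l<N. if l = i then if c = b then 2 * H b b i else 0 else 0)"
    using clifford_anticommute[OF A _ _ i] by (intro sum.cong refl) auto
  also have "\<dots> = 2 * (\<Sum>b\<in>Basis. H b b i)"
    using i by (simp add: sum.delta sum_distrib_left)
  finally show ?thesis by simp
qed

subsection \<open>The constant coefficient operator\<close>

text \<open>
  Sections of the trivial bundle are handled through their components \<open>w 0, \<dots>, w (N - 1)\<close>.
\<close>

definition dirac :: "nat \<Rightarrow> ('a::euclidean_space \<Rightarrow> real mat) \<Rightarrow> (nat \<Rightarrow> 'a \<Rightarrow> real) \<Rightarrow> nat \<Rightarrow> 'a \<Rightarrow> real" where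
  "dirac N A w i x = (\<Sum>b\<in>Basis. \<Sum>k<N. A b $$ (i, k) * partial_deriv b (w k) x)"

lemma smooth_fun_on_dirac:
  "open U \<Longrightarrow> (\<And>k. k < N \<Longrightarrow> smooth_fun_on U (w k)) \<Longrightarrow> smooth_fun_on U (dirac N A w i)"
  unfolding dirac_def[abs_def]
  by (intro smooth_fun_on_sum smooth_fun_on_cmult smooth_fun_on_partial) auto

lemma dirac_dirac:
  assumes A: "clifford_family Basis N A" and U: "open U" "x \<in> U"
    and w: "\<And>k. k < N \<Longrightarrow> smooth_fun_on U (w k)" and i: "i < N"
  shows "dirac N A (dirac N A w) i x = laplacian (w i) x"
proof -
  let ?H = "\<lambda>b c l. partial_deriv b (partial_deriv c (w l)) x"
  have d: "partial_deriv b (dirac N A w k) x = (\<Sum>c\<in>Basis. \<Sum>l<N. A c $$ (k, l) * ?H b c l)" for b k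
  proof -
    have df: "partial_deriv c (w l) differentiable (at x)" if "c \<in> Basis" "l < N" for c l
      using smooth_fun_on_differentiable[OF smooth_fun_on_partial[OF w] U(2)] that by blast
    have "partial_deriv b (dirac N A w k) x
      = (\<Sum>c\<in>Basis. partial_deriv b (\<lambda>y. \<Sum>l<N. A c $$ (k, l) * partial_deriv c (w l) y) x)"
      unfolding dirac_def[abs_def] by (rule partial_deriv_sum) (auto intro!: differentiable_sum df)
    also have "\<dots> = (\<Sum>c\<in>Basis. \<Sum>l<N. partial_deriv b (\<lambda>y. A c $$ (k, l) * partial_deriv c (w l) y) x)"
      by (intro sum.cong refl partial_deriv_sum) (auto intro!: df)
    also have "\<dots> = (\<Sum>c\<in>Basis. \<Sum>l<N. A c $$ (k, l) * ?H b c l)"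
      by (intro sum.cong refl partial_deriv_cmult df) auto
    finally show ?thesis .
  qed
  have "dirac N A (dirac N A w) i x
    = (\<Sum>b\<in>Basis. \<Sum>k<N. \<Sum>c\<in>Basis. \<Sum>l<N. A b $$ (i, k) * (A c $$ (k, l) * ?H b c l))"
    unfolding dirac_def[of N A "dirac N A w"] d by (simp add: sum_distrib_left)
  also have "\<dots> = (\<Sum>b\<in>Basis. \<Sum>c\<in>Basis. \<Sum>k<N. \<Sum>l<N. A b $$ (i, k) * (A c $$ (k, l) * ?H b c l))"
    by (intro sum.cong refl sum.swap)
  also have "\<dots> = (\<Sum>b\<in>Basis. \<Sum>c\<in>Basis. \<Sum>l<N. \<Sum>k<N. A b $$ (i, k) * (A c $$ (k, l) * ?H b c l))"
    by (intro sum.cong refl sum.swap)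
  also have "\<dots> = (\<Sum>b\<in>Basis. \<Sum>c\<in>Basis. \<Sum>l<N. (A b * A c) $$ (i, l) * ?H b c l)"
    using i by (intro sum.cong refl)
      (simp add: mat_mult_entry[OF clifford_carrier[OF A] clifford_carrier[OF A]] sum_distrib_right mult.assoc)
  also have "\<dots> = laplacian (w i) x"
    unfolding laplacian_def
    by (rule clifford_contraction[OF A i]) (rule partial_deriv_commute[OF U(1) w U(2)])
  finally show ?thesis .
qed

lemma dirac_solution_harmonic:
  assumes A: "clifford_family Basis N A" and U: "open U"
    and w: "\<And>k. k < N \<Longrightarrow> smooth_fun_on U (w k)"
    and sol: "\<And>k x. k < N \<Longrightarrow> x \<in> U \<Longrightarrow> dirac N A w k x = 0" and i: "i < N"
  shows "harmonic_on U (w i)"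
  unfolding harmonic_on_def
proof (intro conjI ballI)
  show "smooth_fun_on U (w i)" by (rule w[OF i])
  fix x assume x: "x \<in> U"
  have "partial_deriv b (dirac N A w k) x = 0" if "k < N" for b k
    using partial_deriv_cong[OF U x, of "dirac N A w k" "\<lambda>_. 0" b] sol[OF that] by simp
  then have "dirac N A (dirac N A w) i x = 0"
    unfolding dirac_def[of N A "dirac N A w"] by simp
  then show "laplacian (w i) x = 0" by (simp add: dirac_dirac[OF A U x w i])
qed

lemma dirac_strong_unique_continuation:
  assumes A: "clifford_family Basis N A" and U: "open U" "connected U"
    and w: "\<And>k. k < N \<Longrightarrow> smooth_fun_on U (w k)"
    and sol: "\<And>k x. k < N \<Longrightarrow> x \<in> U \<Longrightarrow> dirac N A w k x = 0"
    and p: "p \<in> U" and flat: "\<And>k bs. k < N \<Longrightarrow> bs \<in> lists Basis \<Longrightarrow> iter_partial bs (w k) p = 0"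
    and i: "i < N" and x: "x \<in> U"
  shows "w i x = 0"
  by (rule harmonic_strong_unique_continuation[OF U dirac_solution_harmonic[OF A U(1) w sol i] p flat[OF i] x])

subsection \<open>Two Dirac operators coupled by a zeroth order term\<close>

text \<open>
  On pairs \<open>(u, v)\<close> of sections of rank \<open>N\<close>, with the components of \<open>v\<close> numbered from \<open>N\<close> on, this is
  the operator that maps \<open>(u, v)\<close> to \<open>(D u, D v - Q u\<^sub>0 e\<^sub>0)\<close>, where \<open>D\<close> is the Dirac operator, \<open>u\<^sub>0\<close> the
  component of \<open>u\<close> with index \<open>0\<close> and \<open>e\<^sub>0\<close> the basis vector with index \<open>0\<close>.
\<close>

definition coupled_dirac ::
    "nat \<Rightarrow> ('a::euclidean_space \<Rightarrow> real mat) \<Rightarrow> ('a \<Rightarrow> real) \<Rightarrow> 'a first_order_op" where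
  "coupled_dirac N A Q = \<lparr>
     dom_rank = N + N, cod_rank = N + N,
     top_coeff = (\<lambda>b x. four_block_mat (A b) (0\<^sub>m N N) (0\<^sub>m N N) (A b)),
     zero_coeff = (\<lambda>x. Matrix.mat (N + N) (N + N) (\<lambda>(i, k). if i = N \<and> k = 0 then - Q x else 0))\<rparr>"

lemma sum_lessThan_double:
  fixes N :: nat
  shows "(\<Sum>k<N + N. f k) = (\<Sum>k<N. f k) + (\<Sum>k<N. f (N + k) :: real)"
proof -
  have "(\<Sum>k<N + M. f k) = (\<Sum>k<N. f k) + (\<Sum>k<M. f (N + k))" for M :: nat
    by (induction M) auto
  then show ?thesis .
qed

lemma coupled_dirac_smooth:
  assumes A: "clifford_family Basis N A" and Q: "smooth_fun_on UNIV Q"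
  shows "smooth_first_order_op (coupled_dirac N A Q)"
  unfolding smooth_first_order_op_def
proof (intro conjI ballI)
  fix b :: 'a assume b: "b \<in> Basis"
  show "smooth_matrix (cod_rank (coupled_dirac N A Q)) (dom_rank (coupled_dirac N A Q)) (top_coeff (coupled_dirac N A Q) b)"
    using clifford_carrier[OF A b] by (auto simp: smooth_matrix_def coupled_dirac_def intro!: smooth_fun_on_const)
next
  have "smooth_fun_on UNIV (\<lambda>x. if i = N \<and> k = 0 then - Q x else 0)" for i k :: nat
    using smooth_fun_on_cmult[OF open_UNIV Q, of "-1"]
    by (cases "i = N \<and> k = 0") (auto intro: smooth_fun_on_const[OF open_UNIV])
  then show "smooth_matrix (cod_rank (coupled_dirac N A Q)) (dom_rank (coupled_dirac N A Q)) (zero_coeff (coupled_dirac N A Q))"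
    by (simp add: smooth_matrix_def coupled_dirac_def)
qed

text \<open>
  The zeroth order term does not enter the symbol, whose square at \<open>\<xi>\<close> is \<open>inner \<xi> \<xi>\<close> times the identity.
\<close>

lemma coupled_dirac_elliptic:
  assumes A: "clifford_family Basis N A"
  shows "elliptic (coupled_dirac N A Q)"
  unfolding elliptic_def
proof (intro allI impI)
  fix x \<xi> :: 'a assume \<xi>: "\<xi> \<noteq> 0"
  define s where "s = Matrix.mat N N (\<lambda>(i, k). \<Sum>b\<in>Basis. A b $$ (i, k) * inner \<xi> b)"
  define S where "S = four_block_mat s (0\<^sub>m N N) (0\<^sub>m N N) s"
  have s: "s \<in> carrier_mat N N" by (simp add: s_def)
  have S: "S \<in> carrier_mat (N + N) (N + N)" using s by (simp add: S_def)
  have PS: "principal_symbol (coupled_dirac N A Q) x \<xi> = S"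
  proof (rule eq_matI)
    fix i k assume "i < dim_row S" "k < dim_col S"
    then have ik: "i < N + N" "k < N + N" using S by auto
    have "four_block_mat (A b) (0\<^sub>m N N) (0\<^sub>m N N) (A b) $$ (i, k)
      = (if i < N then if k < N then A b $$ (i, k) else 0 else if k < N then 0 else A b $$ (i - N, k - N))"
      if "b \<in> Basis" for b using ik clifford_carrier[OF A that] by auto
    then show "principal_symbol (coupled_dirac N A Q) x \<xi> $$ (i, k) = S $$ (i, k)"
      using ik s by (auto simp: principal_symbol_def coupled_dirac_def S_def s_def)
  qed (use S in \<open>auto simp: principal_symbol_def coupled_dirac_def\<close>)
  have ss: "s * s = (inner \<xi> \<xi>) \<cdot>\<^sub>m 1\<^sub>m N"
  proof (rule eq_matI)
    fix i j assume "i < dim_row (inner \<xi> \<xi> \<cdot>\<^sub>m 1\<^sub>m N)" "j < dim_col (inner \<xi> \<xi> \<cdot>\<^sub>m 1\<^sub>m N)"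
    then have ij: "i < N" "j < N" by auto
    have "(s * s) $$ (i, j) = (\<Sum>k<N. (\<Sum>b\<in>Basis. A b $$ (i, k) * inner \<xi> b) * (\<Sum>c\<in>Basis. A c $$ (k, j) * inner \<xi> c))"
      using ij by (simp add: mat_mult_entry[OF s s]) (simp add: s_def)
    also have "\<dots> = (\<Sum>k<N. \<Sum>b\<in>Basis. \<Sum>c\<in>Basis. A b $$ (i, k) * A c $$ (k, j) * (inner \<xi> b * inner \<xi> c))"
      unfolding sum_product by (intro sum.cong refl) (simp add: mult_ac)
    also have "\<dots> = (\<Sum>b\<in>Basis. \<Sum>k<N. \<Sum>c\<in>Basis. A b $$ (i, k) * A c $$ (k, j) * (inner \<xi> b * inner \<xi> c))"
      by (rule sum.swap)
    also have "\<dots> = (\<Sum>b\<in>Basis. \<Sum>c\<in>Basis. \<Sum>k<N. A b $$ (i, k) * A c $$ (k, j) * (inner \<xi> b * inner \<xi> c))"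
      by (intro sum.cong refl sum.swap)
    also have "\<dots> = (\<Sum>b\<in>Basis. \<Sum>c\<in>Basis. (A b * A c) $$ (i, j) * (inner \<xi> b * inner \<xi> c))"
      using ij by (intro sum.cong refl)
        (simp add: mat_mult_entry[OF clifford_carrier[OF A] clifford_carrier[OF A]] sum_distrib_right)
    also have "\<dots> = (\<Sum>b\<in>Basis. \<Sum>c\<in>Basis. \<Sum>l<N. (A b * A c) $$ (i, l) * (if l = j then inner \<xi> b * inner \<xi> c else 0))"
      using ij by (simp add: if_distrib[of "\<lambda>z. _ * z"] sum.delta cong: if_cong)
    also have "\<dots> = (\<Sum>b\<in>Basis. (if i = j then inner \<xi> b * inner \<xi> b else 0))"
      by (rule clifford_contraction[OF A ij(1)]) (simp add: mult.commute)
    also have "\<dots> = (if i = j then inner \<xi> \<xi> else 0)"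
      by (simp add: euclidean_inner[of \<xi> \<xi>])
    finally show "(s * s) $$ (i, j) = (inner \<xi> \<xi> \<cdot>\<^sub>m 1\<^sub>m N) $$ (i, j)" using ij by simp
  qed (use s in auto)
  have SS: "S * S = inner \<xi> \<xi> \<cdot>\<^sub>m 1\<^sub>m (N + N)"
  proof -
    have "S * S = four_block_mat (s * s) (0\<^sub>m N N) (0\<^sub>m N N) (s * s)"
      unfolding S_def using s by (simp add: mult_four_block_mat[of _ N N _ N _ N _ _ N _ N])
    also have "\<dots> = inner \<xi> \<xi> \<cdot>\<^sub>m 1\<^sub>m (N + N)" unfolding ss by (rule eq_matI) auto
    finally show ?thesis .
  qed
  have ne: "inner \<xi> \<xi> \<noteq> 0" using \<xi> by simp
  let ?T = "(1 / inner \<xi> \<xi>) \<cdot>\<^sub>m S"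
  have "S * ?T = 1\<^sub>m (N + N)" "?T * S = 1\<^sub>m (N + N)"
    using S ne by (auto simp: mult_smult_distrib[OF S S] mult_smult_assoc_mat[OF S S] SS intro!: eq_matI)
  then show "invertible_mat (principal_symbol (coupled_dirac N A Q) x \<xi>)"
    unfolding PS invertible_mat_def inverts_mat_def using S by auto
qed

lemma apply_coupled_dirac:
  assumes A: "clifford_family Basis N A"
  shows "i < N \<Longrightarrow> vec_index (apply_op (coupled_dirac N A Q) \<phi> x) i = dirac N A (\<lambda>k y. vec_index (\<phi> y) k) i x"
    and "i < N \<Longrightarrow> vec_index (apply_op (coupled_dirac N A Q) \<phi> x) (N + i)
      = dirac N A (\<lambda>k y. vec_index (\<phi> y) (N + k)) i x - (if i = 0 then Q x * vec_index (\<phi> x) 0 else 0)"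
proof -
  have c: "dim_row (A b) = N" "dim_col (A b) = N" if "b \<in> Basis" for b
    using clifford_carrier[OF A that] by auto
  show "vec_index (apply_op (coupled_dirac N A Q) \<phi> x) i = dirac N A (\<lambda>k y. vec_index (\<phi> y) k) i x"
    if "i < N"
    using that by (simp add: apply_op_def coupled_dirac_def dirac_def sum_lessThan_double c)
  show "vec_index (apply_op (coupled_dirac N A Q) \<phi> x) (N + i)
      = dirac N A (\<lambda>k y. vec_index (\<phi> y) (N + k)) i x - (if i = 0 then Q x * vec_index (\<phi> x) 0 else 0)"
    if "i < N"
  proof -
    have "(\<Sum>k<N + N. zero_coeff (coupled_dirac N A Q) x $$ (N + i, k) * vec_index (\<phi> x) k)
      = (\<Sum>k<N + N. if k = 0 then if i = 0 then - Q x * vec_index (\<phi> x) 0 else 0 else 0)"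
      using that by (intro sum.cong refl) (auto simp: coupled_dirac_def)
    also have "\<dots> = (if i = 0 then - Q x * vec_index (\<phi> x) 0 else 0)"
      using that by (simp add: sum.delta)
    finally have z: "(\<Sum>k<N + N. zero_coeff (coupled_dirac N A Q) x $$ (N + i, k) * vec_index (\<phi> x) k)
      = (if i = 0 then - Q x * vec_index (\<phi> x) 0 else 0)" .
    have t: "(\<Sum>k<N + N. top_coeff (coupled_dirac N A Q) b x $$ (N + i, k) * partial_deriv b (\<lambda>y. vec_index (\<phi> y) k) x)
      = (\<Sum>k<N. A b $$ (i, k) * partial_deriv b (\<lambda>y. vec_index (\<phi> y) (N + k)) x)" if b: "b \<in> Basis" for b
      using \<open>i < N\<close> c[OF b] by (simp add: sum_lessThan_double coupled_dirac_def)
    have r: "dom_rank (coupled_dirac N A Q) = N + N" "cod_rank (coupled_dirac N A Q) = N + N"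
      by (simp_all add: coupled_dirac_def)
    show ?thesis
      using that unfolding apply_op_def r by (simp add: t z dirac_def)
  qed
qed

text \<open>
  The coupling is triangular: \<open>u\<close> solves the Dirac equation by itself, hence vanishes if it is flat at
  one point, and then the coupling term is gone and the same argument applies to \<open>v\<close>.
\<close>

lemma coupled_dirac_strong_unique_continuation:
  assumes A: "clifford_family Basis N A" and N: "N > 0"
  shows "strong_unique_continuation (coupled_dirac N A Q)"
  unfolding strong_unique_continuation_def
proof (intro allI impI)
  fix U and \<phi> :: "'a \<Rightarrow> real Matrix.vec"
  have r: "dom_rank (coupled_dirac N A Q) = N + N" "cod_rank (coupled_dirac N A Q) = N + N"
    by (simp_all add: coupled_dirac_def)
  assume "open U \<and> connected U \<and> solution_on (coupled_dirac N A Q) U \<phi>"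
  then have U: "open U" "connected U" and sec: "smooth_section_on (N + N) U \<phi>"
    and sol: "\<And>x. x \<in> U \<Longrightarrow> apply_op (coupled_dirac N A Q) \<phi> x = 0\<^sub>v (N + N)"
    by (auto simp: solution_on_def r)
  have sm: "smooth_fun_on U (\<lambda>y. vec_index (\<phi> y) k)" if "k < N + N" for k
    using sec that by (simp add: smooth_section_on_def)
  have "\<forall>x\<in>U. \<phi> x = 0\<^sub>v (N + N)" if ne: "infinite_order_zeros (N + N) U \<phi> \<noteq> {}"
  proof -
    obtain p where p: "p \<in> U" "\<And>k. vanishes_of_order (N + N) k \<phi> p"
      using ne by (auto simp: infinite_order_zeros_def)
    have flat: "iter_partial bs (\<lambda>y. vec_index (\<phi> y) k) p = 0" if "bs \<in> lists Basis" "k < N + N" for bs k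
      using p(2)[of "Suc (length bs)"] that unfolding vanishes_of_order_def by blast
    have u0: "vec_index (\<phi> x) i = 0" if "i < N" "x \<in> U" for i x
    proof (rule dirac_strong_unique_continuation[OF A U, where w = "\<lambda>k y. vec_index (\<phi> y) k"])
      show "dirac N A (\<lambda>k y. vec_index (\<phi> y) k) k x = 0" if "k < N" "x \<in> U" for k x
        using apply_coupled_dirac(1)[OF A that(1), of Q \<phi> x] sol[OF that(2)] that(1) by simp
      show "iter_partial bs (\<lambda>y. vec_index (\<phi> y) k) p = 0" if "k < N" "bs \<in> lists Basis" for k bs
        by (rule flat) (use that in auto)
    qed (use sm p that in auto)
    have v0: "vec_index (\<phi> x) (N + i) = 0" if "i < N" "x \<in> U" for i x
    proof (rule dirac_strong_unique_continuation[OF A U, where w = "\<lambda>k y. vec_index (\<phi> y) (N + k)"])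
      show "dirac N A (\<lambda>k y. vec_index (\<phi> y) (N + k)) k x = 0" if "k < N" "x \<in> U" for k x
        using apply_coupled_dirac(2)[OF A that(1), of Q \<phi> x] sol[OF that(2)] that(1) u0[OF N that(2)] by simp
      show "iter_partial bs (\<lambda>y. vec_index (\<phi> y) (N + k)) p = 0" if "k < N" "bs \<in> lists Basis" for k bs
        by (rule flat) (use that in auto)
    qed (use sm p that in auto)
    show ?thesis
    proof
      fix x assume x: "x \<in> U"
      show "\<phi> x = 0\<^sub>v (N + N)"
      proof (rule eq_vecI)
        fix i assume "i < dim_vec (0\<^sub>v (N + N) :: real Matrix.vec)"
        then show "vec_index (\<phi> x) i = vec_index (0\<^sub>v (N + N)) i"
          using u0[OF _ x, of i] v0[OF _ x, of "i - N"] by (cases "i < N") auto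
      qed (use sec x in \<open>auto simp: smooth_section_on_def\<close>)
    qed
  qed
  then show "infinite_order_zeros (dom_rank (coupled_dirac N A Q)) U \<phi> = {}
    \<or> (\<forall>x\<in>U. \<phi> x = 0\<^sub>v (dom_rank (coupled_dirac N A Q)))"
    unfolding r by blast
qed

section \<open>The solution with prescribed zero set\<close>

lemma has_derivative_comp_snd:
  fixes f :: "'b::euclidean_space \<Rightarrow> real" and x :: "'a::euclidean_space \<times> 'b"
  assumes "f differentiable (at (snd x))"
  shows "((\<lambda>x. f (snd x)) has_derivative (\<lambda>h. partial_deriv (snd h) f (snd x))) (at x)"
  by (rule has_derivative_compose[of snd snd x UNIV f, OF _ has_derivative_partial[OF assms]])
    (intro has_derivative_snd has_derivative_ident)

lemma smooth_fun_on_snd: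
  fixes f :: "'b::euclidean_space \<Rightarrow> real"
  assumes "smooth_fun_on UNIV f"
  shows "smooth_fun_on UNIV (\<lambda>x::'a::euclidean_space \<times> 'b. f (snd x))"
proof (rule smooth_fun_on_coinduct[where F = "(\<lambda>g x. g (snd x)) ` Collect (smooth_fun_on UNIV)"])
  let ?F = "(\<lambda>g (x::'a \<times> 'b). g (snd x)) ` Collect (smooth_fun_on UNIV)"
  show "g differentiable (at x)" if "g \<in> ?F" for g x
    using that has_derivative_comp_snd[OF smooth_fun_on_differentiable] unfolding differentiable_def by blast
  show "\<exists>h\<in>?F. \<forall>x\<in>UNIV. partial_deriv b g x = h x" if g: "g \<in> ?F" for g b
  proof -
    obtain k where k: "smooth_fun_on UNIV k" "g = (\<lambda>x. k (snd x))" using g by auto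
    have "partial_deriv b g x = partial_deriv (snd b) k (snd x)" for x
      unfolding k(2) by (rule partial_deriv_frechet) (rule has_derivative_comp_snd[OF smooth_fun_on_differentiable[OF k(1) UNIV_I]])
    then show ?thesis
      using smooth_fun_on_directional[OF open_UNIV k(1), of "snd b"]
      by (intro bexI[of _ "\<lambda>x. partial_deriv (snd b) k (snd x)"]) auto
  qed
qed (use assms in auto)

text \<open>
  Since \<open>F\<close> is constant in the direction \<open>e\<close>, the cross term in the Leibniz rule vanishes.
\<close>

lemma laplacian_coordinate_mult:
  fixes F :: "'a::euclidean_space \<Rightarrow> real"
  assumes F: "smooth_fun_on UNIV F" and indep: "\<And>x. partial_deriv e F x = 0"
  shows "laplacian (\<lambda>y. inner y e * F y) x = inner x e * laplacian F x"
proof -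
  have "(\<Sum>b\<in>Basis. partial_deriv b (\<lambda>y. inner y e) x * partial_deriv b F x) = partial_deriv e F x"
    using partial_deriv_basis_expansion[OF smooth_fun_on_differentiable[OF F UNIV_I], of e x]
    by (simp add: inner_commute)
  moreover have "laplacian (\<lambda>y. inner y e) x = 0"
  proof -
    have "partial_deriv b (\<lambda>y. inner y e) = (\<lambda>_. inner b e)" for b by (rule ext) simp
    then show ?thesis by (simp add: laplacian_def)
  qed
  ultimately show ?thesis
    using laplacian_mult[OF open_UNIV smooth_fun_on_inner[OF open_UNIV] F UNIV_I, of e x] indep by simp
qed

text \<open>
  Write \<open>x1\<close>, \<open>x2\<close> for the coordinates along \<open>e1\<close>, \<open>e2\<close>, and \<open>D\<close> for the Dirac operator. The second
  component \<open>v\<close> of the solution is \<open>D (x1 F e\<^sub>0)\<close>. By \<open>dirac_dirac\<close> and \<open>laplacian_coordinate_mult\<close>,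
  \<open>D v\<close> is \<open>x1\<close> times the Laplacian of \<open>F\<close> times \<open>e\<^sub>0\<close>. So it remains to find a solution \<open>u\<close> of
  \<open>D u = 0\<close> whose component of index \<open>0\<close> is \<open>x1\<close>. Such a solution is \<open>x1 e\<^sub>0 - x2 (A e2 * A e1) e\<^sub>0\<close>,
  since the matrix product is skew; it vanishes exactly where \<open>x1 = x2 = 0\<close>. There the Leibniz rule
  leaves \<open>v = F (A e1) e\<^sub>0\<close>, which vanishes exactly where \<open>F\<close> does.
\<close>

lemma coupled_dirac_solution:
  fixes F :: "'a::euclidean_space \<Rightarrow> real" and e1 e2 :: 'a
  assumes A: "clifford_family Basis N A" and N: "N > 0"
    and e: "e1 \<in> Basis" "e2 \<in> Basis" "e1 \<noteq> e2"
    and F: "smooth_fun_on UNIV F" and indep: "\<And>x. partial_deriv e1 F x = 0"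
  shows "\<exists>\<phi>. solution_on (coupled_dirac N A (laplacian F)) UNIV \<phi> \<and>
    (\<forall>x. \<phi> x = 0\<^sub>v (N + N) \<longleftrightarrow> inner x e1 = 0 \<and> inner x e2 = 0 \<and> F x = 0)"
proof -
  let ?D = "coupled_dirac N A (laplacian F)"
  have r: "dom_rank ?D = N + N" "cod_rank ?D = N + N" by (simp_all add: coupled_dirac_def)
  note c1 = clifford_carrier[OF A e(1)] and c2 = clifford_carrier[OF A e(2)]
  \<comment> \<open>The vector \<open>(A e2 * A e1) e\<^sub>0\<close>.\<close>
  define G where "G k = (A e2 * A e1) $$ (k, 0)" for k
  have G0: "G 0 = 0"
    unfolding G_def using e N by (intro clifford_product_diagonal[OF A]) auto
  have A2G: "(\<Sum>k<N. A e2 $$ (i, k) * G k) = A e1 $$ (i, 0)" if i: "i < N" for i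
  proof -
    have "(\<Sum>k<N. A e2 $$ (i, k) * G k) = (A e2 * (A e2 * A e1)) $$ (i, 0)"
      unfolding G_def using i N by (simp only: mat_mult_entry[OF c2 mult_carrier_mat[OF c2 c1]])
    also have "A e2 * (A e2 * A e1) = A e1"
      using c1 by (simp add: assoc_mult_mat[OF c2 c2 c1, symmetric] clifford_square[OF A e(2)])
    finally show ?thesis .
  qed
  obtain k1 where k1: "k1 < N" "A e1 $$ (k1, 0) \<noteq> 0"
  proof -
    have "(A e1 * A e1) $$ (0, 0) = 1" using N by (simp add: clifford_square[OF A e(1)])
    then have "(\<Sum>k<N. A e1 $$ (0, k) * A e1 $$ (k, 0)) \<noteq> 0" using N by (simp add: mat_mult_entry[OF c1 c1])
    then obtain k where "k \<in> {..<N}" "A e1 $$ (0, k) * A e1 $$ (k, 0) \<noteq> 0"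
      by (rule sum.not_neutral_contains_not_neutral)
    then show ?thesis by (intro that[of k]) auto
  qed
  obtain k2 where k2: "k2 < N" "G k2 \<noteq> 0"
  proof -
    have "(\<Sum>k<N. A e2 $$ (k1, k) * G k) \<noteq> 0" using A2G[OF k1(1)] k1(2) by simp
    then obtain k where "k \<in> {..<N}" "A e2 $$ (k1, k) * G k \<noteq> 0"
      by (rule sum.not_neutral_contains_not_neutral)
    then show ?thesis by (intro that[of k]) auto
  qed
  define u where "u k x = (if k = 0 then inner x e1 else 0) - G k * inner x e2" for k :: nat and x
  define w where "w k x = (if k = 0 then inner x e1 * F x else 0)" for k :: nat and x
  define v where "v = dirac N A w"
  define \<phi> where "\<phi> x = Matrix.vec (N + N) (\<lambda>k. if k < N then u k x else v (k - N) x)" for x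
  have sin: "smooth_fun_on UNIV (\<lambda>x. inner x a)" for a :: 'a by (simp add: smooth_fun_on_inner)
  have sx: "smooth_fun_on UNIV (\<lambda>x. if k = 0 then inner x e1 else 0)" for k :: nat
    using sin by (cases "k = 0") (auto intro: smooth_fun_on_const)
  have su: "smooth_fun_on UNIV (u k)" for k
    unfolding u_def[abs_def] by (intro smooth_fun_on_diff sx smooth_fun_on_cmult sin) auto
  have sw: "smooth_fun_on UNIV (w k)" for k
    unfolding w_def[abs_def] by (cases "k = 0")
      (auto intro!: smooth_fun_on_const smooth_fun_on_mult sin F)
  have sv: "smooth_fun_on UNIV (v k)" for k
    unfolding v_def by (intro smooth_fun_on_dirac sw) simp
  have \<phi>u: "(\<lambda>y. vec_index (\<phi> y) k) = u k" if "k < N" for k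
    using that by (auto simp: \<phi>_def)
  have \<phi>v: "(\<lambda>y. vec_index (\<phi> y) (N + k)) = v k" if "k < N" for k
    using that by (auto simp: \<phi>_def)
  have du: "dirac N A u i x = 0" if i: "i < N" for i x
  proof -
    have "partial_deriv b (u k) x = (if k = 0 then inner b e1 else 0) - G k * inner b e2" for b k
    proof -
      have "partial_deriv b (u k) x = partial_deriv b (\<lambda>x. if k = 0 then inner x e1 else 0) x
        - partial_deriv b (\<lambda>x. G k * inner x e2) x"
        unfolding u_def[abs_def]
        by (intro partial_deriv_diff smooth_fun_on_differentiable[OF _ UNIV_I] sx smooth_fun_on_cmult sin) auto
      also have "partial_deriv b (\<lambda>x. G k * inner x e2) x = G k * inner b e2"
        by (simp add: partial_deriv_cmult smooth_fun_on_differentiable[OF sin])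
      also have "partial_deriv b (\<lambda>x. if k = 0 then inner x e1 else 0) x = (if k = 0 then inner b e1 else 0)"
        by (cases "k = 0") auto
      finally show ?thesis .
    qed
    then have "dirac N A u i x = (\<Sum>b\<in>Basis. inner b e1 * A b $$ (i, 0) - inner b e2 * (\<Sum>k<N. A b $$ (i, k) * G k))"
      unfolding dirac_def using N
      by (intro sum.cong refl) (simp add: right_diff_distrib sum_subtractf if_distrib[of "\<lambda>z. _ * z"]
          sum.delta sum_distrib_left mult_ac cong: if_cong)
    also have "\<dots> = A e1 $$ (i, 0) - (\<Sum>k<N. A e2 $$ (i, k) * G k)"
      using e by (simp add: sum_subtractf inner_Basis if_distrib[of "\<lambda>z. z * _"] sum.delta cong: if_cong)
    finally show ?thesis by (simp add: A2G[OF i])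
  qed
  have dv: "dirac N A v i x = (if i = 0 then laplacian F x * inner x e1 else 0)" if i: "i < N" for i x
    unfolding v_def dirac_dirac[OF A open_UNIV UNIV_I sw i]
    unfolding w_def[abs_def]
    by (cases "i = 0") (simp_all add: laplacian_coordinate_mult[OF F indep] laplacian_const)
  have v_axis: "v k x = A e1 $$ (k, 0) * F x" if x: "inner x e1 = 0" for k x
  proof -
    have "partial_deriv b (w l) x = (if l = 0 then inner b e1 * F x else 0)" for b l
      unfolding w_def[abs_def] using x
      by (cases "l = 0") (simp_all add: partial_deriv_mult smooth_fun_on_differentiable[OF sin] smooth_fun_on_differentiable[OF F])
    then have "v k x = (\<Sum>b\<in>Basis. inner b e1 * (A b $$ (k, 0) * F x))"
      unfolding v_def dirac_def using N
      by (intro sum.cong refl) (simp add: if_distrib[of "\<lambda>z. _ * z"] sum.delta mult_ac cong: if_cong)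
    also have "\<dots> = A e1 $$ (k, 0) * F x"
      using e by (simp add: inner_Basis if_distrib[of "\<lambda>z. z * _"] sum.delta cong: if_cong)
    finally show ?thesis .
  qed
  have sol: "solution_on ?D UNIV \<phi>"
    unfolding solution_on_def r smooth_section_on_def
  proof (intro conjI ballI allI impI)
    show "\<phi> x \<in> carrier_vec (N + N)" for x by (simp add: \<phi>_def)
    show "smooth_fun_on UNIV (\<lambda>x. vec_index (\<phi> x) i)" if "i < N + N" for i
      using \<phi>u[of i] \<phi>v[of "i - N"] su sv that by (cases "i < N") auto
    show "apply_op ?D \<phi> x = 0\<^sub>v (N + N)" for x
    proof (rule eq_vecI)
      have "dirac N A (\<lambda>k y. vec_index (\<phi> y) k) i x = dirac N A u i x" for i
        unfolding dirac_def by (intro sum.cong refl) (simp add: \<phi>u)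
      then have 1: "vec_index (apply_op ?D \<phi> x) i = 0" if "i < N" for i
        using that du by (simp add: apply_coupled_dirac[OF A])
      have "dirac N A (\<lambda>k y. vec_index (\<phi> y) (N + k)) i x = dirac N A v i x" for i
        unfolding dirac_def by (intro sum.cong refl) (simp add: \<phi>v)
      moreover have "vec_index (\<phi> x) 0 = inner x e1" using N G0 by (simp add: \<phi>_def u_def)
      ultimately have 2: "vec_index (apply_op ?D \<phi> x) (N + i) = 0" if "i < N" for i
        using that dv by (simp add: apply_coupled_dirac[OF A])
      fix i assume "i < dim_vec (0\<^sub>v (N + N) :: real Matrix.vec)"
      then show "vec_index (apply_op ?D \<phi> x) i = vec_index (0\<^sub>v (N + N)) i"
        using 1[of i] 2[of "i - N"] by (cases "i < N") auto
    qed (simp add: apply_op_def r)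
  qed
  have zero: "\<phi> x = 0\<^sub>v (N + N) \<longleftrightarrow> inner x e1 = 0 \<and> inner x e2 = 0 \<and> F x = 0" for x
  proof
    assume z: "\<phi> x = 0\<^sub>v (N + N)"
    have uz: "u k x = 0" if "k < N" for k
      using fun_cong[OF \<phi>u[OF that], of x] z that by simp
    have vz: "v k x = 0" if "k < N" for k
      using fun_cong[OF \<phi>v[OF that], of x] z that by simp
    have x1: "inner x e1 = 0" using uz[OF N] G0 by (simp add: u_def)
    moreover have "inner x e2 = 0" using uz[OF k2(1)] k2(2) x1 by (simp add: u_def split: if_splits)
    moreover have "F x = 0" using vz[OF k1(1)] v_axis[OF x1, of k1] k1(2) by simp
    ultimately show "inner x e1 = 0 \<and> inner x e2 = 0 \<and> F x = 0" by simp
  next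
    assume "inner x e1 = 0 \<and> inner x e2 = 0 \<and> F x = 0"
    then show "\<phi> x = 0\<^sub>v (N + N)"
      using v_axis[of x] by (intro eq_vecI) (auto simp: \<phi>_def u_def)
  qed
  show ?thesis using sol zero by blast
qed

theorem theorem1:
  fixes A :: "(real ^ 'm) set"
  assumes "closed A"
  shows "\<exists>(D :: ((real \<times> real) \<times> (real ^ 'm)) first_order_op) \<phi>.
           smooth_first_order_op D \<and> elliptic D \<and> solution_on D UNIV \<phi> \<and>
           zero_set (dom_rank D) UNIV \<phi> = {(0, 0)} \<times> A \<and>
           strong_unique_continuation D"
proof -
  obtain f where f: "smooth_fun_on UNIV f" "\<And>y. f y = 0 \<longleftrightarrow> y \<in> A"
    using closed_is_smooth_zero_set[OF assms] by blast
  define F :: "(real \<times> real) \<times> (real ^ 'm) \<Rightarrow> real" where "F x = f (snd x)" for x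
  have F: "smooth_fun_on UNIV F" unfolding F_def[abs_def] by (rule smooth_fun_on_snd[OF f(1)])
  obtain N and C :: "(real \<times> real) \<times> (real ^ 'm) \<Rightarrow> real mat"
    where N: "N > 0" and C: "clifford_family Basis N C"
    using clifford_family_exists[OF finite_Basis] by blast
  define e1 e2 :: "(real \<times> real) \<times> (real ^ 'm)" where "e1 = ((1, 0), 0)" and "e2 = ((0, 1), 0)"
  have e: "e1 \<in> Basis" "e2 \<in> Basis" "e1 \<noteq> e2" by (auto simp: e1_def e2_def Basis_prod_def)
  have "partial_deriv e1 F x = 0" for x
    by (simp add: partial_deriv_def F_def e1_def)
  then obtain \<phi> where \<phi>: "solution_on (coupled_dirac N C (laplacian F)) UNIV \<phi>"
    "\<And>x. \<phi> x = 0\<^sub>v (N + N) \<longleftrightarrow> inner x e1 = 0 \<and> inner x e2 = 0 \<and> F x = 0"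
    using coupled_dirac_solution[OF C N e F] by blast
  have "zero_set (N + N) UNIV \<phi> = {(0, 0)} \<times> A"
    by (auto simp: zero_set_def \<phi>(2) e1_def e2_def F_def f(2))
  then have "zero_set (dom_rank (coupled_dirac N C (laplacian F))) UNIV \<phi> = {(0, 0)} \<times> A"
    by (simp add: coupled_dirac_def)
  then show ?thesis
    using coupled_dirac_smooth[OF C smooth_fun_on_laplacian[OF open_UNIV F]]
      coupled_dirac_elliptic[OF C, of "laplacian F"]
      coupled_dirac_strong_unique_continuation[OF C N, of "laplacian F"] \<phi>(1)
    by (intro exI[of _ "coupled_dirac N C (laplacian F)"] exI[of _ \<phi>] conjI)
qed

end
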